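(* Let $N\ge1$, let $X=X(\mathbb Z_+^N)$ be an ISL on $\mathbb Z_+^N$ which contains $\ell^1(\mathbb Z_+^N)$ and for which the finitely supported sequences are norm dense in $X'$. Let $f$ be a linearly factorable polynomial in $\mathbb C^N$ such that $f(\zeta)\ne0$ for all $\zeta\in\mathbb D^N$. Then $f$ is cyclic in $X_A(\mathbb D^N)$ for the weak topology $\sigma(X,X')$. In particular, for $N=1$, every polynomial $f$ with $f(\zeta)\neq0$ for $\zeta\in\mathbb D$ is cyclic in any such ISL; for example, it is norm cyclic in $\ell^p_A(\mathbb D)$ for every $1<p<\infty$ and, generally, in any reflexive ISL containing $\ell^1$.
   Context: $\mathbb D=\{z\in\mathbb C:|z|<1\}$. An ISL on $\mathbb Z_+^N$ is a Banach space $X$ of complex families $x=(x_\alpha)_{\alpha\in\mathbb Z_+^N}$ such that: (i) $x\in X$ and $|y_\alpha|\le|x_\alpha|$ for all $\alpha$ imply $y\in X$, $\|y\|_X\le\|x\|_X$; (ii) for every $\beta\in\mathbb Z_+^N$ the shift $\sum_\alpha x_\alpha\delta_\alpha\mapsto\sum_\alpha x_\alpha\delta_{\alpha+\beta}$ maps $X$ into $X$; (iii) the unit vector $\delta_0$ (hence every $\delta_\alpha$) is in $X$. $X'=\{y:\sum_\alpha|x_\alpha y_\alpha|<\infty\ \forall x\in X\}$, with dual norm $\|y\|=\sup\{|\langle x,y\rangle|:\|x\|_X\le1\}$, $\langle x,y\rangle=\sum_\alpha x_\alpha y_\alpha$; $\sigma(X,X')$ is the corresponding weak topology on $X$. $X_A(\mathbb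 D^N)$ is the space of power series $\sum_\alpha x_\alpha\zeta^\alpha$, $x\in X$, identified with $X$ (same norm and topologies); $\ell^p_A(\mathbb D)$ is the case $X=\ell^p(\mathbb Z_+)$. An element $f$ is cyclic if $\{pf:p\text{ a polynomial in }\zeta_1,\dots,\zeta_N\}$ is dense in the indicated topology. A polynomial $f$ in $\mathbb C^N$ is linearly factorable if $f=\prod_{j=1}^nf_j$ with affine linear $f_j(\zeta)=a+\sum_{i=1}^Na_i\zeta_i$ ($a,a_i\in\mathbb C$ depending on $j$). *)

theory Defs
  imports
    "HOL-Analysis.Analysis"
    "HOL-Computational_Algebra.Polynomial"
    "HOL-Library.Poly_Mapping"
begin

text \<open>
  Multi-indices range over a cancellative commutative monoid, which is instantiated to
  \<open>nat ^ 'n\<close> (for \<open>N = CARD('n)\<close> variables) and to \<open>nat\<close> (one variable).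
  A formal power series is identified with its family of coefficients, so \<open>X\<^sub>A\<close> is
  \<open>X\<close> itself.  A space of families is a carrier set together with a norm function, of which
  only the values on the carrier matter.
\<close>

section \<open>Normed spaces of complex families\<close>

text \<open>
  \<^locale>\<open>Metric_space\<close> wants nonnegativity and symmetry also outside the carrier, whence
  the case distinction.
\<close>

definition norm_dist ::
    "('a \<Rightarrow> complex) set \<Rightarrow> (('a \<Rightarrow> complex) \<Rightarrow> real) \<Rightarrow> ('a \<Rightarrow> complex) \<Rightarrow> ('a \<Rightarrow> complex) \<Rightarrow> real"
  where "norm_dist X nrm x y = (if x \<in> X \<and> y \<in> X then nrm (\<lambda>\<alpha>. x \<alpha> - y \<alpha>) else 0)"

definition norm_topology :: "('a \<Rightarrow> complex) set \<Rightarrow> (('a \<Rightarrow> complex) \<Rightarrow> real) \<Rightarrow> ('a \<Rightarrow> complex) topology"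
  where "norm_topology X nrm = Metric_space.mtopology X (norm_dist X nrm)"

locale normed_family_space =
  fixes X :: "('a \<Rightarrow> complex) set" and nrm :: "('a \<Rightarrow> complex) \<Rightarrow> real"
  assumes zero_mem: "(\<lambda>\<alpha>. 0) \<in> X"
    and add_mem: "x \<in> X \<Longrightarrow> y \<in> X \<Longrightarrow> (\<lambda>\<alpha>. x \<alpha> + y \<alpha>) \<in> X"
    and scale_mem: "x \<in> X \<Longrightarrow> (\<lambda>\<alpha>. c * x \<alpha>) \<in> X"
    and nrm_nonneg: "x \<in> X \<Longrightarrow> 0 \<le> nrm x"
    and nrm_eq_0_iff: "x \<in> X \<Longrightarrow> nrm x = 0 \<longleftrightarrow> x = (\<lambda>\<alpha>. 0)"
    and nrm_triangle: "x \<in> X \<Longrightarrow> y \<in> X \<Longrightarrow> nrm (\<lambda>\<alpha>. x \<alpha> + y \<alpha>) \<le> nrm x + nrm y"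
    and nrm_scale: "x \<in> X \<Longrightarrow> nrm (\<lambda>\<alpha>. c * x \<alpha>) = cmod c * nrm x"
begin

lemma minus_mem:
  assumes "x \<in> X" "y \<in> X"
  shows "(\<lambda>\<alpha>. x \<alpha> - y \<alpha>) \<in> X"
  using add_mem[OF assms(1) scale_mem[OF assms(2), of "-1"]] by simp

lemma Metric_space_norm_dist: "Metric_space X (norm_dist X nrm)"
proof
  fix x y
  show "0 \<le> norm_dist X nrm x y"
    by (simp add: norm_dist_def nrm_nonneg minus_mem)
  have "nrm (\<lambda>\<alpha>. x \<alpha> - y \<alpha>) = nrm (\<lambda>\<alpha>. y \<alpha> - x \<alpha>)" if "x \<in> X" "y \<in> X"
    using nrm_scale[OF minus_mem[OF that], of "-1"] by simp
  then show "norm_dist X nrm x y = norm_dist X nrm y x"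
    by (simp add: norm_dist_def)
next
  fix x y assume "x \<in> X" "y \<in> X"
  then show "norm_dist X nrm x y = 0 \<longleftrightarrow> x = y"
    by (simp add: norm_dist_def nrm_eq_0_iff minus_mem fun_eq_iff)
next
  fix x y z assume "x \<in> X" "y \<in> X" "z \<in> X"
  then show "norm_dist X nrm x z \<le> norm_dist X nrm x y + norm_dist X nrm y z"
    using nrm_triangle[of "\<lambda>\<alpha>. x \<alpha> - y \<alpha>" "\<lambda>\<alpha>. y \<alpha> - z \<alpha>"]
    by (simp add: norm_dist_def minus_mem)
qed

end

locale banach_family_space = normed_family_space +
  assumes complete: "Metric_space.mcomplete X (norm_dist X nrm)"


section \<open>Ideal sequence spaces with shifts\<close>

definition shift :: "'i::cancel_comm_monoid_add \<Rightarrow> ('i \<Rightarrow> complex) \<Rightarrow> 'i \<Rightarrow> complex"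
  where "shift \<beta> x = (\<lambda>\<gamma>. if \<exists>\<alpha>. \<gamma> = \<alpha> + \<beta> then x (\<gamma> - \<beta>) else 0)"

definition unit_family :: "'i \<Rightarrow> 'i \<Rightarrow> complex"
  where "unit_family \<beta> = (\<lambda>\<alpha>. if \<alpha> = \<beta> then 1 else 0)"

locale ISL = banach_family_space X nrm
  for X :: "('i::cancel_comm_monoid_add \<Rightarrow> complex) set" and nrm +
  assumes solid: "x \<in> X \<Longrightarrow> (\<And>\<alpha>. cmod (y \<alpha>) \<le> cmod (x \<alpha>)) \<Longrightarrow> y \<in> X \<and> nrm y \<le> nrm x"
    and shift_mem: "x \<in> X \<Longrightarrow> shift \<beta> x \<in> X"
    and unit_mem: "unit_family 0 \<in> X"

definition lp_space :: "real \<Rightarrow> ('i \<Rightarrow> complex) set"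
  where "lp_space p = {x. (\<lambda>\<alpha>. cmod (x \<alpha>) powr p) summable_on UNIV}"

definition lp_norm :: "real \<Rightarrow> ('i \<Rightarrow> complex) \<Rightarrow> real"
  where "lp_norm p x = (\<Sum>\<^sub>\<infinity>\<alpha>. cmod (x \<alpha>) powr p) powr (1 / p)"


section \<open>The dual \<open>X'\<close> and the weak topology\<close>

definition seq_dual :: "('i \<Rightarrow> complex) set \<Rightarrow> ('i \<Rightarrow> complex) set"
  where "seq_dual X = {y. \<forall>x\<in>X. (\<lambda>\<alpha>. cmod (x \<alpha> * y \<alpha>)) summable_on UNIV}"

definition pairing :: "('i \<Rightarrow> complex) \<Rightarrow> ('i \<Rightarrow> complex) \<Rightarrow> complex"
  where "pairing x y = (\<Sum>\<^sub>\<infinity>\<alpha>. x \<alpha> * y \<alpha>)"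

text \<open>The supremum is finite for \<open>y \<in> seq_dual X\<close> if \<open>X\<close> is an ISL.\<close>

definition seq_dual_norm ::
    "('i \<Rightarrow> complex) set \<Rightarrow> (('i \<Rightarrow> complex) \<Rightarrow> real) \<Rightarrow> ('i \<Rightarrow> complex) \<Rightarrow> real"
  where "seq_dual_norm X nrm y = Sup {cmod (pairing x y) | x. x \<in> X \<and> nrm x \<le> 1}"

definition weak_topology :: "('i \<Rightarrow> complex) set \<Rightarrow> ('i \<Rightarrow> complex) topology"
  where "weak_topology X =
    topology_generated_by {{x \<in> X. pairing x y \<in> U} | y U. y \<in> seq_dual X \<and> open U}"

lemma topspace_weak_topology: "topspace (weak_topology X) = X"
proof -
  have "(\<lambda>_. 0) \<in> seq_dual X"
    by (simp add: seq_dual_def)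
  then have "{x \<in> X. pairing x (\<lambda>_. 0) \<in> UNIV} \<in>
      {{x \<in> X. pairing x y \<in> U} | y U. y \<in> seq_dual X \<and> open U}"
    by blast
  then show ?thesis
    unfolding weak_topology_def topology_generated_by_topspace by auto
qed

definition dense_in_topology :: "'a topology \<Rightarrow> 'a set \<Rightarrow> bool"
  where "dense_in_topology T S \<longleftrightarrow> S \<subseteq> topspace T \<and> T closure_of S = topspace T"

definition finite_families_dense_in_dual ::
    "('i \<Rightarrow> complex) set \<Rightarrow> (('i \<Rightarrow> complex) \<Rightarrow> real) \<Rightarrow> bool"
  where "finite_families_dense_in_dual X nrm \<longleftrightarrow>
    dense_in_topology (norm_topology (seq_dual X) (seq_dual_norm X nrm)) {y. finite {\<alpha>. y \<alpha> \<noteq> 0}}"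


section \<open>Reflexivity\<close>

text \<open>
  The Banach space dual consists of functions on the function space \<open>V\<close>, hence is again a
  space of complex families and the construction can be iterated.  Functionals are extended by
  \<open>0\<close> outside \<open>V\<close> so that a functional on \<open>V\<close> is represented by exactly one function.
\<close>

definition banach_dual ::
    "('a \<Rightarrow> complex) set \<Rightarrow> (('a \<Rightarrow> complex) \<Rightarrow> real) \<Rightarrow> (('a \<Rightarrow> complex) \<Rightarrow> complex) set"
  where "banach_dual V nrm = {\<phi>.
    (\<forall>x\<in>V. \<forall>y\<in>V. \<phi> (\<lambda>\<alpha>. x \<alpha> + y \<alpha>) = \<phi> x + \<phi> y) \<and>
    (\<forall>x\<in>V. \<forall>c. \<phi> (\<lambda>\<alpha>. c * x \<alpha>) = c * \<phi> x) \<and>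
    (\<exists>C. \<forall>x\<in>V. cmod (\<phi> x) \<le> C * nrm x) \<and>
    (\<forall>x. x \<notin> V \<longrightarrow> \<phi> x = 0)}"

definition banach_dual_norm ::
    "('a \<Rightarrow> complex) set \<Rightarrow> (('a \<Rightarrow> complex) \<Rightarrow> real) \<Rightarrow> (('a \<Rightarrow> complex) \<Rightarrow> complex) \<Rightarrow> real"
  where "banach_dual_norm V nrm \<phi> = Sup {cmod (\<phi> x) | x. x \<in> V \<and> nrm x \<le> 1}"

definition reflexive_space :: "('a \<Rightarrow> complex) set \<Rightarrow> (('a \<Rightarrow> complex) \<Rightarrow> real) \<Rightarrow> bool"
  where "reflexive_space V nrm \<longleftrightarrow>
    (\<forall>\<Phi> \<in> banach_dual (banach_dual V nrm) (banach_dual_norm V nrm).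
       \<exists>x\<in>V. \<forall>\<phi> \<in> banach_dual V nrm. \<Phi> \<phi> = \<phi> x)"


section \<open>Polynomials and cyclicity\<close>

text \<open>
  \<open>'i \<Rightarrow>\<^sub>0 complex\<close> with its convolution product is the ring of polynomials with exponents
  in \<open>'i\<close>.  The product below is that of a polynomial with a formal power series.
\<close>

definition poly_times ::
    "('i::cancel_comm_monoid_add \<Rightarrow>\<^sub>0 complex) \<Rightarrow> ('i \<Rightarrow> complex) \<Rightarrow> 'i \<Rightarrow> complex"
  where "poly_times p x =
    (\<lambda>\<gamma>. \<Sum>\<beta>\<in>Poly_Mapping.keys p. Poly_Mapping.lookup p \<beta> * shift \<beta> x \<gamma>)"

definition cyclic_element ::
    "('i::cancel_comm_monoid_add \<Rightarrow> complex) topology \<Rightarrow> ('i \<Rightarrow> complex) \<Rightarrow> bool"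
  where "cyclic_element T f \<longleftrightarrow> f \<in> topspace T \<and> dense_in_topology T {poly_times p f | p. True}"

definition mpoly_eval :: "(nat ^ 'n \<Rightarrow>\<^sub>0 complex) \<Rightarrow> complex ^ 'n \<Rightarrow> complex"
  where "mpoly_eval f \<zeta> =
    (\<Sum>\<alpha>\<in>Poly_Mapping.keys f. Poly_Mapping.lookup f \<alpha> * (\<Prod>i\<in>UNIV. (\<zeta> $ i) ^ (\<alpha> $ i)))"

definition polydisc :: "(complex ^ 'n) set"
  where "polydisc = {\<zeta>. \<forall>i. cmod (\<zeta> $ i) < 1}"

definition affine_linear :: "(nat ^ 'n \<Rightarrow>\<^sub>0 complex) \<Rightarrow> bool"
  where "affine_linear g \<longleftrightarrow>
    (\<exists>a c. g = Poly_Mapping.single 0 a + (\<Sum>i\<in>UNIV. Poly_Mapping.single (axis i 1) (c i)))"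

definition linearly_factorable :: "(nat ^ 'n \<Rightarrow>\<^sub>0 complex) \<Rightarrow> bool"
  where "linearly_factorable f \<longleftrightarrow>
    (\<exists>(n::nat) g. (\<forall>j\<in>{1..n}. affine_linear (g j)) \<and> f = (\<Prod>j\<in>{1..n}. g j))"

end

theory Submission
  imports Defs "HOL-Computational_Algebra.Fundamental_Theorem_Algebra"
begin

text \<open>
  By duality, \<open>f\<close> is cyclic as soon as \<open>f(S\<^sup>*)\<close>, where \<open>S\<^sup>*\<close> denotes the backward shifts, is
  injective on the dual.  If \<open>X\<close> contains \<open>\<ell>\<^sup>1\<close> and the finite families are dense in \<open>X'\<close>, then
  \<open>X'\<close> consists of families vanishing at infinity, and it suffices to treat a single factor
  \<open>a + \<Sum>\<^sub>i a\<^sub>i \<zeta>\<^sub>i\<close>.  Having no zero in the polydisc means \<open>\<Sum>\<^sub>i \<bar>a\<^sub>i\<bar> \<le> \<bar>a\<bar> \<noteq> 0\<close>, so a family \<open>y\<close> in the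
  kernel satisfies \<open>\<bar>y(\<alpha>)\<bar> \<le> max\<^sub>i \<bar>y(\<alpha> + e\<^sub>i)\<bar>\<close> and is \<open>0\<close> by the maximum principle.

  For the norm topologies, density is tested on the Banach dual by the Hahn--Banach theorem, and one
  needs that a functional \<open>\<phi>\<close> is determined by the values \<open>\<phi>(\<delta>\<^sub>\<alpha>)\<close> and that these vanish at infinity.
  In \<open>\<ell>\<^sup>p\<close> both are direct; in a reflexive space both follow by representing suitable functionals on
  the dual by elements of \<open>X\<close>.
\<close>

section \<open>Separation in spaces of families\<close>

text \<open>Vanishing at infinity is what compensates for zeros of \<open>f\<close> on the boundary
  of the polydisc. There the bound on the coefficients may be an equality, and the maximum principle
  only moves a value of y to a higher degree without decreasing it. A bounded family can do this
  forever: 1 - \<zeta> annihilates the constants, so in \<ell>^1, whose dual is \<ell>^\<infinity>,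
  this polynomial is not weakly cyclic. In the weak case the hypotheses on X enter through one
  estimate: the inclusion of \<ell>^1 bounds the norms of the unit families, so convergence in X' is
  uniform, and uniform limits of finite families vanish at infinity. Single factors suffice because
  passing from \<open>f\<close> to its operator turns products into compositions and each operator
  preserves vanishing at infinity. A weak neighbourhood constrains finitely many functionals, so
  weak density is linear algebra. For the norm, a functional need not a priori be given by a family
  in X', whence the two conditions on its values at unit families.\<close>

definition family_subspace :: "('a \<Rightarrow> complex) set \<Rightarrow> bool"
  where "family_subspace W \<longleftrightarrow> (\<lambda>_. 0) \<in> W
    \<and> (\<forall>x\<in>W. \<forall>y\<in>W. (\<lambda>\<alpha>. x \<alpha> + y \<alpha>) \<in> W) \<and> (\<forall>x\<in>W. \<forall>c. (\<lambda>\<alpha>. c * x \<alpha>) \<in> W)"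

lemma family_subspaceD:
  assumes "family_subspace W"
  shows "(\<lambda>_. 0) \<in> W" and "x \<in> W \<Longrightarrow> y \<in> W \<Longrightarrow> (\<lambda>\<alpha>. x \<alpha> + y \<alpha>) \<in> W"
    and "x \<in> W \<Longrightarrow> (\<lambda>\<alpha>. c * x \<alpha>) \<in> W"
  using assms by (auto simp: family_subspace_def)

lemma family_subspace_uminus: "family_subspace W \<Longrightarrow> x \<in> W \<Longrightarrow> (\<lambda>\<alpha>. - x \<alpha>) \<in> W"
  using family_subspaceD(3)[of W x "-1"] by simp

lemma family_subspace_diff:
  assumes "family_subspace W" "x \<in> W" "y \<in> W"
  shows "(\<lambda>\<alpha>. x \<alpha> - y \<alpha>) \<in> W"
  using family_subspaceD(2)[OF assms(1,2) family_subspace_uminus[OF assms(1,3)]] by simp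

section \<open>The Hahn--Banach theorem by maximal cones of constraints\<close>

context normed_family_space
begin

lemma family_subspace_carrier: "family_subspace X"
  by (simp add: family_subspace_def zero_mem add_mem scale_mem)

lemma uminus_mem: "x \<in> X \<Longrightarrow> (\<lambda>\<alpha>. - x \<alpha>) \<in> X"
  using scale_mem[of x "-1"] by simp

lemma nrm_zero: "nrm (\<lambda>_. 0) = 0"
  using nrm_eq_0_iff zero_mem by blast

lemma nrm_uminus: "x \<in> X \<Longrightarrow> nrm (\<lambda>\<alpha>. - x \<alpha>) = nrm x"
  using nrm_scale[of x "-1"] by simp

lemma nrm_le_add_nrm:
  assumes "x \<in> X" "k \<in> X"
  shows "nrm k \<le> nrm (\<lambda>\<alpha>. x \<alpha> + k \<alpha>) + nrm x"
  using nrm_triangle[OF add_mem[OF assms] uminus_mem[OF assms(1)]] assms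
  by (simp add: nrm_uminus)

text \<open>A pair \<open>(k, r)\<close> encodes the demand - r \<le> l k on a real functional l
  that is still to be found and is to be bounded by \<open>nrm\<close>. The inequality
  \<open>0 \<le> nrm k + r\<close> is the consistency of this demand with l k \<le>
  \<open>nrm k\<close>.\<close>

definition nonneg_cone :: "(('a \<Rightarrow> complex) \<times> real) set \<Rightarrow> bool"
  where "nonneg_cone K \<longleftrightarrow>
    (\<forall>k r. (k, r) \<in> K \<longrightarrow> k \<in> X \<and> 0 \<le> nrm k + r) \<and>
    (\<forall>k r l s. (k, r) \<in> K \<longrightarrow> (l, s) \<in> K \<longrightarrow> ((\<lambda>\<alpha>. k \<alpha> + l \<alpha>), r + s) \<in> K) \<and>
    (\<forall>k r t. (k, r) \<in> K \<longrightarrow> 0 \<le> t \<longrightarrow> ((\<lambda>\<alpha>. complex_of_real t * k \<alpha>), t * r) \<in> K)"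

lemma nonneg_coneD:
  assumes "nonneg_cone K"
  shows "(k, r) \<in> K \<Longrightarrow> k \<in> X" and "(k, r) \<in> K \<Longrightarrow> 0 \<le> nrm k + r"
    and "(k, r) \<in> K \<Longrightarrow> (l, s) \<in> K \<Longrightarrow> ((\<lambda>\<alpha>. k \<alpha> + l \<alpha>), r + s) \<in> K"
    and "(k, r) \<in> K \<Longrightarrow> 0 \<le> t \<Longrightarrow> ((\<lambda>\<alpha>. complex_of_real t * k \<alpha>), t * r) \<in> K"
  using assms unfolding nonneg_cone_def by blast+

lemma nonneg_cone_Union:
  assumes "subset.chain (Collect nonneg_cone) \<C>"
  shows "nonneg_cone (\<Union>\<C>)"
proof -
  have cone: "nonneg_cone K" if "K \<in> \<C>" for K
    using assms that by (auto simp: subset.chain_def)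
  have total: "K \<subseteq> L \<or> L \<subseteq> K" if "K \<in> \<C>" "L \<in> \<C>" for K L
    using assms that by (auto simp: subset_chain_def)
  show ?thesis
    unfolding nonneg_cone_def
  proof (intro conjI allI impI)
    fix k r l s assume "(k, r) \<in> \<Union>\<C>" "(l, s) \<in> \<Union>\<C>"
    then obtain K L where "K \<in> \<C>" "(k, r) \<in> K" "L \<in> \<C>" "(l, s) \<in> L" by blast
    then obtain M where "M \<in> \<C>" "(k, r) \<in> M" "(l, s) \<in> M"
      using total[of K L] by blast
    then show "((\<lambda>\<alpha>. k \<alpha> + l \<alpha>), r + s) \<in> \<Union>\<C>"
      using nonneg_coneD(3)[OF cone] by blast
  qed (use nonneg_coneD(1,2,4)[OF cone] in blast)+
qed

text \<open>
  The value at \<open>x\<close> of the functional determined by a maximal cone \<open>K\<close>.  Since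
  \<open>(x, - cone_functional K x)\<close> may be added to the cone, it belongs to it, which turns the
  sublinear infimum into a linear functional.
\<close>

definition cone_functional :: "(('a \<Rightarrow> complex) \<times> real) set \<Rightarrow> ('a \<Rightarrow> complex) \<Rightarrow> real"
  where "cone_functional K x = Inf ((\<lambda>(k, r). nrm (\<lambda>\<alpha>. x \<alpha> + k \<alpha>) + r) ` K)"

lemma cone_functional_bound:
  assumes "nonneg_cone K" "x \<in> X" "(k, r) \<in> K"
  shows "- nrm x \<le> nrm (\<lambda>\<alpha>. x \<alpha> + k \<alpha>) + r"
  using nonneg_coneD(1,2)[OF assms(1,3)] nrm_le_add_nrm[OF assms(2), of k] by linarith

lemma cone_functional_le:
  assumes "nonneg_cone K" "x \<in> X" "(k, r) \<in> K"
  shows "cone_functional K x \<le> nrm (\<lambda>\<alpha>. x \<alpha> + k \<alpha>) + r"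
  unfolding cone_functional_def
proof (rule cInf_lower)
  show "bdd_below ((\<lambda>(k, r). nrm (\<lambda>\<alpha>. x \<alpha> + k \<alpha>) + r) ` K)"
    using cone_functional_bound[OF assms(1,2)] by (intro bdd_belowI[of _ "- nrm x"]) auto
qed (use assms in auto)

lemma cone_functional_approx:
  assumes "K \<noteq> {}" "cone_functional K x < b"
  shows "\<exists>k r. (k, r) \<in> K \<and> nrm (\<lambda>\<alpha>. x \<alpha> + k \<alpha>) + r < b"
  using cInf_lessD[of "(\<lambda>(k, r). nrm (\<lambda>\<alpha>. x \<alpha> + k \<alpha>) + r) ` K" b] assms
  unfolding cone_functional_def by auto

lemma cone_functional_add_le:
  assumes K: "nonneg_cone K" "K \<noteq> {}" and x: "x \<in> X" and y: "y \<in> X"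
  shows "cone_functional K (\<lambda>\<alpha>. x \<alpha> + y \<alpha>) \<le> cone_functional K x + cone_functional K y"
proof (rule field_le_epsilon)
  fix e :: real assume "0 < e"
  then obtain k r l s where k: "(k, r) \<in> K" "nrm (\<lambda>\<alpha>. x \<alpha> + k \<alpha>) + r < cone_functional K x + e / 2"
    and l: "(l, s) \<in> K" "nrm (\<lambda>\<alpha>. y \<alpha> + l \<alpha>) + s < cone_functional K y + e / 2"
    using cone_functional_approx[OF K(2), of x "cone_functional K x + e / 2"]
      cone_functional_approx[OF K(2), of y "cone_functional K y + e / 2"] by fastforce
  have mem: "k \<in> X" "l \<in> X"
    using k l nonneg_coneD(1)[OF K(1)] by blast+
  have "cone_functional K (\<lambda>\<alpha>. x \<alpha> + y \<alpha>) \<le> nrm (\<lambda>\<alpha>. x \<alpha> + y \<alpha> + (k \<alpha> + l \<alpha>)) + (r + s)"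
    using cone_functional_le[OF K(1) add_mem[OF x y] nonneg_coneD(3)[OF K(1) k(1) l(1)]] by simp
  also have "(\<lambda>\<alpha>. x \<alpha> + y \<alpha> + (k \<alpha> + l \<alpha>)) = (\<lambda>\<alpha>. (x \<alpha> + k \<alpha>) + (y \<alpha> + l \<alpha>))"
    by (simp add: algebra_simps)
  also have "nrm \<dots> \<le> nrm (\<lambda>\<alpha>. x \<alpha> + k \<alpha>) + nrm (\<lambda>\<alpha>. y \<alpha> + l \<alpha>)"
    by (intro nrm_triangle add_mem x y mem)
  finally show "cone_functional K (\<lambda>\<alpha>. x \<alpha> + y \<alpha>) \<le> cone_functional K x + cone_functional K y + e"
    using k l by linarith
qed

lemma cone_functional_scale_le:
  assumes K: "nonneg_cone K" "K \<noteq> {}" and x: "x \<in> X" and t: "0 < t"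
  shows "cone_functional K (\<lambda>\<alpha>. complex_of_real t * x \<alpha>) \<le> t * cone_functional K x"
proof (rule field_le_epsilon)
  fix e :: real assume "0 < e"
  then obtain k r where k: "(k, r) \<in> K" "nrm (\<lambda>\<alpha>. x \<alpha> + k \<alpha>) + r < cone_functional K x + e / t"
    using cone_functional_approx[OF K(2), of x "cone_functional K x + e / t"] t by fastforce
  have mem: "k \<in> X"
    using k nonneg_coneD(1)[OF K(1)] by blast
  have "cone_functional K (\<lambda>\<alpha>. complex_of_real t * x \<alpha>)
      \<le> nrm (\<lambda>\<alpha>. complex_of_real t * x \<alpha> + complex_of_real t * k \<alpha>) + t * r"
    using cone_functional_le[OF K(1) scale_mem[OF x] nonneg_coneD(4)[OF K(1) k(1)]] t by simp
  also have "(\<lambda>\<alpha>. complex_of_real t * x \<alpha> + complex_of_real t * k \<alpha>)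
      = (\<lambda>\<alpha>. complex_of_real t * (x \<alpha> + k \<alpha>))"
    by (simp add: algebra_simps)
  also have "nrm \<dots> = t * nrm (\<lambda>\<alpha>. x \<alpha> + k \<alpha>)"
    using nrm_scale[OF add_mem[OF x mem]] t by simp
  also have "\<dots> + t * r = t * (nrm (\<lambda>\<alpha>. x \<alpha> + k \<alpha>) + r)"
    by (simp add: algebra_simps)
  also have "\<dots> \<le> t * (cone_functional K x + e / t)"
    using k t by (intro mult_left_mono) auto
  also have "\<dots> = t * cone_functional K x + e"
    using t by (simp add: algebra_simps)
  finally show "cone_functional K (\<lambda>\<alpha>. complex_of_real t * x \<alpha>) \<le> t * cone_functional K x + e" .
qed

text \<open>The new cone adds to the old demands the single demand - c \<le> l x; the hypothesis on
  \<open>c\<close> is precisely consistency of all its combinations with the old ones.\<close>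

lemma nonneg_cone_extend:
  assumes K: "nonneg_cone K" and x: "x \<in> X"
    and c: "\<And>k r t. (k, r) \<in> K \<Longrightarrow> 0 \<le> t \<Longrightarrow>
      0 \<le> nrm (\<lambda>\<alpha>. k \<alpha> + complex_of_real t * x \<alpha>) + (r + t * c)"
  shows "nonneg_cone ((\<lambda>((k, r), t). ((\<lambda>\<alpha>. k \<alpha> + complex_of_real t * x \<alpha>), r + t * c)) ` (K \<times> {0..}))"
    (is "nonneg_cone ?K")
proof -
  have mem: "((\<lambda>\<alpha>. k \<alpha> + complex_of_real t * x \<alpha>), r + t * c) \<in> ?K" if "(k, r) \<in> K" "0 \<le> t" for k r t
    using that by force
  show ?thesis
    unfolding nonneg_cone_def
  proof (intro conjI allI impI)
    fix k' r' assume "(k', r') \<in> ?K"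
    then obtain k r t where *: "(k, r) \<in> K" "0 \<le> t" "k' = (\<lambda>\<alpha>. k \<alpha> + complex_of_real t * x \<alpha>)" "r' = r + t * c"
      by auto
    then show "k' \<in> X" "0 \<le> nrm k' + r'"
      using nonneg_coneD(1)[OF K *(1)] c[OF *(1,2)] x by (auto intro: add_mem scale_mem)
    fix s :: real assume s: "0 \<le> s"
    show "((\<lambda>\<alpha>. complex_of_real s * k' \<alpha>), s * r') \<in> ?K"
      using mem[OF nonneg_coneD(4)[OF K *(1) s], of "s * t"] s *(2)
      by (simp add: *(3,4) algebra_simps)
  next
    fix k' r' l' s' assume "(k', r') \<in> ?K" "(l', s') \<in> ?K"
    then obtain k r t l s u where *: "(k, r) \<in> K" "0 \<le> t" "k' = (\<lambda>\<alpha>. k \<alpha> + complex_of_real t * x \<alpha>)" "r' = r + t * c"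
      and **: "(l, s) \<in> K" "0 \<le> u" "l' = (\<lambda>\<alpha>. l \<alpha> + complex_of_real u * x \<alpha>)" "s' = s + u * c"
      by auto
    show "((\<lambda>\<alpha>. k' \<alpha> + l' \<alpha>), r' + s') \<in> ?K"
      using mem[OF nonneg_coneD(3)[OF K *(1) **(1)], of "t + u"] *(2) **(2)
      by (simp add: *(3,4) **(3,4) algebra_simps)
  qed
qed

text \<open>The demand \<open>(w, 0)\<close> asks for 0 \<le> l w, which on a subspace forces l w =
  0, and \<open>(v, - d)\<close> asks for d \<le> l v. A maximal cone containing these demands
  leaves no freedom in l, so its functional is linear.\<close>

lemma exists_real_functional:
  assumes W: "family_subspace W" "W \<subseteq> X" and v: "v \<in> X"
    and d: "\<And>w. w \<in> W \<Longrightarrow> d \<le> nrm (\<lambda>\<alpha>. w \<alpha> + v \<alpha>)"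
  shows "\<exists>l :: ('a \<Rightarrow> complex) \<Rightarrow> real.
    (\<forall>x\<in>X. \<forall>y\<in>X. l (\<lambda>\<alpha>. x \<alpha> + y \<alpha>) = l x + l y) \<and>
    (\<forall>x\<in>X. \<forall>t. l (\<lambda>\<alpha>. complex_of_real t * x \<alpha>) = t * l x) \<and>
    (\<forall>x\<in>X. \<bar>l x\<bar> \<le> nrm x) \<and> (\<forall>w\<in>W. l w = 0) \<and> d \<le> l v"
proof -
  have "nonneg_cone (W \<times> {0})"
    using W by (auto simp: nonneg_cone_def family_subspaceD nrm_nonneg)
  \<comment> \<open>Division by \<open>t\<close> reduces consistency of the ray through
    \<open>(v, - d)\<close> to the distance hypothesis, because \<open>W\<close> is closed under
    scaling.\<close>
  moreover have "0 \<le> nrm (\<lambda>\<alpha>. w \<alpha> + complex_of_real t * v \<alpha>) + (0 + t * (- d))" if w: "w \<in> W" and t: "0 \<le> t" for w t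
  proof (cases "t = 0")
    case False
    have mem: "(\<lambda>\<alpha>. complex_of_real (1 / t) * w \<alpha> + v \<alpha>) \<in> X"
      using w W(2) by (intro add_mem scale_mem v) auto
    from False have "t * d \<le> t * nrm (\<lambda>\<alpha>. complex_of_real (1 / t) * w \<alpha> + v \<alpha>)"
      using t d[OF family_subspaceD(3)[OF W(1) w, of "complex_of_real (1 / t)"]] by (intro mult_left_mono)
    also have "\<dots> = nrm (\<lambda>\<alpha>. complex_of_real t * (complex_of_real (1 / t) * w \<alpha> + v \<alpha>))"
      using t nrm_scale[OF mem, of "complex_of_real t"] by simp
    also have "(\<lambda>\<alpha>. complex_of_real t * (complex_of_real (1 / t) * w \<alpha> + v \<alpha>)) = (\<lambda>\<alpha>. w \<alpha> + complex_of_real t * v \<alpha>)"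
      using False by (simp add: algebra_simps)
    finally show ?thesis by simp
  qed (use w W nrm_nonneg in auto)
  moreover define K0 where
    "K0 = (\<lambda>((k, r), t). ((\<lambda>\<alpha>. k \<alpha> + complex_of_real t * v \<alpha>), r + t * (- d))) ` ((W \<times> {0}) \<times> {0..})"
  ultimately have K0_cone: "nonneg_cone K0"
    unfolding K0_def by (intro nonneg_cone_extend v) auto
  have K0w: "(w, 0) \<in> K0" if "w \<in> W" for w
    unfolding K0_def by (rule image_eqI[where x = "((w, 0), 0)"]) (use that in auto)
  have K0v: "(v, - d) \<in> K0"
    unfolding K0_def by (rule image_eqI[where x = "(((\<lambda>_. 0), 0), 1)"]) (use family_subspaceD(1)[OF W(1)] in auto)
  let ?A = "{K. nonneg_cone K \<and> K0 \<subseteq> K}"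
  have "\<exists>K\<in>?A. \<forall>L\<in>?A. K \<subseteq> L \<longrightarrow> L = K"
  proof (rule subset_Zorn_nonempty)
    show "?A \<noteq> {}"
      using K0_cone by blast
    fix \<C> assume ne: "\<C> \<noteq> {}" and chain: "subset.chain ?A \<C>"
    have "subset.chain (Collect nonneg_cone) \<C>"
      using chain by (auto simp: subset_chain_def)
    then have "nonneg_cone (\<Union>\<C>)"
      by (rule nonneg_cone_Union)
    moreover have "K0 \<subseteq> \<Union>\<C>"
      using ne chain unfolding subset_chain_def by blast
    ultimately show "\<Union>\<C> \<in> ?A" by blast
  qed
  then obtain K where KA: "K \<in> ?A" and Kmax: "\<forall>L\<in>?A. K \<subseteq> L \<longrightarrow> L = K" ..
  then have K: "nonneg_cone K" and K0: "K0 \<subseteq> K" by simp_all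
  have max: "L = K" if "nonneg_cone L" "K \<subseteq> L" for L
    using Kmax that K0 by simp
  define l where "l = cone_functional K"
  have zero: "((\<lambda>_. 0), 0) \<in> K"
    using K0 K0w family_subspaceD(1)[OF W(1)] by blast
  then have ne: "K \<noteq> {}" by blast
  note l_le = cone_functional_le[OF K, folded l_def]
  have l_add: "l (\<lambda>\<alpha>. x \<alpha> + y \<alpha>) \<le> l x + l y" if "x \<in> X" "y \<in> X" for x y
    using cone_functional_add_le[OF K ne that] by (simp add: l_def)
  have l_scale: "l (\<lambda>\<alpha>. complex_of_real t * x \<alpha>) \<le> t * l x" if "x \<in> X" "0 < t" for x t
    using cone_functional_scale_le[OF K ne that] by (simp add: l_def)
  have l_nrm: "l x \<le> nrm x" if "x \<in> X" for x
    using l_le[OF that zero] by simp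
  have l_zero: "l (\<lambda>_. 0) = 0"
    using l_add[OF zero_mem zero_mem] l_nrm[OF zero_mem] nrm_zero by simp
  have "(x, - l x) \<in> K" if x: "x \<in> X" for x
  proof -
    have ge: "0 \<le> nrm (\<lambda>\<alpha>. k \<alpha> + complex_of_real t * x \<alpha>) + (r + t * (- l x))"
      if k: "(k, r) \<in> K" and t: "0 \<le> t" for k r t
    proof (cases "t = 0")
      case False
      then have t: "0 < t" using t by simp
      \<comment> \<open>This is the inequality opposite to \<open>l_scale\<close>, obtained by
        scaling back with 1 / t.\<close>
      have "t * l x \<le> l (\<lambda>\<alpha>. complex_of_real t * x \<alpha>)"
        using l_scale[OF scale_mem[OF x, of "complex_of_real t"], of "1 / t"] t by (simp add: field_simps)
      also have "\<dots> \<le> nrm (\<lambda>\<alpha>. complex_of_real t * x \<alpha> + k \<alpha>) + r"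
        by (rule l_le[OF scale_mem[OF x] k])
      finally show ?thesis by (simp add: add.commute)
    qed (use nonneg_coneD(2)[OF K k] in simp)
    let ?L = "(\<lambda>((k, r), t). ((\<lambda>\<alpha>. k \<alpha> + complex_of_real t * x \<alpha>), r + t * (- l x))) ` (K \<times> {0..})"
    have "nonneg_cone ?L"
      by (rule nonneg_cone_extend[OF K x ge])
    moreover have "K \<subseteq> ?L"
    proof
      fix k assume "k \<in> K"
      then show "k \<in> ?L" by (intro image_eqI[where x = "(k, 0)"]) (auto split: prod.split)
    qed
    ultimately have "?L = K" by (rule max)
    moreover have "(x, - l x) \<in> ?L"
      by (rule image_eqI[where x = "(((\<lambda>_. 0), 0), 1)"]) (use zero in auto)
    ultimately show ?thesis by blast
  qed
  \<comment> \<open>The pair \<open>(x, - l x)\<close> competes in the infimum that defines l at -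
    x, where it contributes the norm of 0 minus \<open>l x\<close>.\<close>
  then have l_neg_le: "l (\<lambda>\<alpha>. - x \<alpha>) \<le> - l x" if "x \<in> X" for x
    using l_le[OF uminus_mem[OF that], of x "- l x"] that nrm_zero by simp
  have l_neg: "l (\<lambda>\<alpha>. - x \<alpha>) = - l x" if "x \<in> X" for x
    using l_neg_le[OF that] l_add[OF that uminus_mem[OF that]] l_zero by simp
  show ?thesis
  proof (intro exI[of _ l] conjI ballI allI)
    show "l (\<lambda>\<alpha>. x \<alpha> + y \<alpha>) = l x + l y" if "x \<in> X" "y \<in> X" for x y
      using l_add[OF that] l_add[OF add_mem[OF that] uminus_mem[OF that(2)]] l_neg[OF that(2)] by simp
    have pos: "l (\<lambda>\<alpha>. complex_of_real t * x \<alpha>) = t * l x" if "x \<in> X" "0 < t" for x t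
      using l_scale[OF that] l_scale[OF scale_mem[OF that(1), of "complex_of_real t"], of "1 / t"] that
      by (simp add: field_simps)
    show "l (\<lambda>\<alpha>. complex_of_real t * x \<alpha>) = t * l x" if "x \<in> X" for x t
      using pos[OF that, of t] pos[OF uminus_mem[OF that], of "- t"] l_neg[OF that] l_zero
      by (cases t "0::real" rule: linorder_cases) auto
    show "\<bar>l x\<bar> \<le> nrm x" if "x \<in> X" for x
      using l_nrm[OF that] l_nrm[OF uminus_mem[OF that]] l_neg[OF that] nrm_uminus[OF that] by simp
    show "l w = 0" if w: "w \<in> W" for w
    proof -
      have "l x \<le> 0" if "x \<in> W" for x
        using l_le[of x "\<lambda>\<alpha>. - x \<alpha>" 0] K0 K0w[OF family_subspace_uminus[OF W(1) that]] that W(2) nrm_zero by auto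
      from this[OF w] this[OF family_subspace_uminus[OF W(1) w]] show ?thesis
        using l_neg[of w] w W(2) by auto
    qed
    show "d \<le> l v"
      using l_le[OF uminus_mem[OF v], of v "- d"] K0 K0v l_neg[OF v] nrm_zero by auto
  qed
qed

lemma banach_dualI:
  assumes "\<And>x y. x \<in> X \<Longrightarrow> y \<in> X \<Longrightarrow> \<phi> (\<lambda>\<alpha>. x \<alpha> + y \<alpha>) = \<phi> x + \<phi> y"
    and "\<And>x c. x \<in> X \<Longrightarrow> \<phi> (\<lambda>\<alpha>. c * x \<alpha>) = c * \<phi> x"
    and "\<And>x. x \<in> X \<Longrightarrow> cmod (\<phi> x) \<le> C * nrm x" and "\<And>x. x \<notin> X \<Longrightarrow> \<phi> x = 0"
  shows "\<phi> \<in> banach_dual X nrm"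
  using assms unfolding banach_dual_def by blast

lemma exists_separating_functional:
  assumes W: "family_subspace W" "W \<subseteq> X" and v: "v \<in> X" and "0 < d"
    and d: "\<And>w. w \<in> W \<Longrightarrow> d \<le> nrm (\<lambda>\<alpha>. w \<alpha> + v \<alpha>)"
  obtains \<phi> where "\<phi> \<in> banach_dual X nrm" "\<And>w. w \<in> W \<Longrightarrow> \<phi> w = 0" "\<phi> v \<noteq> 0"
proof -
  obtain l :: "('a \<Rightarrow> complex) \<Rightarrow> real"
    where l: "\<forall>x\<in>X. \<forall>y\<in>X. l (\<lambda>\<alpha>. x \<alpha> + y \<alpha>) = l x + l y"
      "\<forall>x\<in>X. \<forall>t. l (\<lambda>\<alpha>. complex_of_real t * x \<alpha>) = t * l x" "\<forall>x\<in>X. \<bar>l x\<bar> \<le> nrm x"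
      "\<forall>w\<in>W. l w = 0" "d \<le> l v"
    using exists_real_functional[OF W v d] by auto
  note add = l(1)[rule_format] and scale = l(2)[rule_format] and bound = l(3)[rule_format]
    and W0 = l(4)[rule_format] and lv = l(5)
  \<comment> \<open>The usual complexification l(x) - i l(i x). The crude constant 2 below is
    enough, since only boundedness of \<phi> is asked for.\<close>
  define \<phi> where "\<phi> x = (if x \<in> X then Complex (l x) (- l (\<lambda>\<alpha>. \<i> * x \<alpha>)) else 0)" for x
  have "\<phi> (\<lambda>\<alpha>. x \<alpha> + y \<alpha>) = \<phi> x + \<phi> y" if "x \<in> X" "y \<in> X" for x y
    using add[OF that] add[of "\<lambda>\<alpha>. \<i> * x \<alpha>" "\<lambda>\<alpha>. \<i> * y \<alpha>"] that
    by (simp add: \<phi>_def add_mem scale_mem algebra_simps complex_eq_iff)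
  moreover have "\<phi> (\<lambda>\<alpha>. c * x \<alpha>) = c * \<phi> x" if x: "x \<in> X" for c x
  proof -
    have ix: "(\<lambda>\<alpha>. \<i> * x \<alpha>) \<in> X" by (rule scale_mem[OF x])
    have "l (\<lambda>\<alpha>. (complex_of_real a * x \<alpha>) + complex_of_real b * (\<i> * x \<alpha>)) = a * l x + b * l (\<lambda>\<alpha>. \<i> * x \<alpha>)" for a b
      using add[OF scale_mem[OF x] scale_mem[OF ix]] scale[OF x] scale[OF ix] by simp
    note lin = this
    have "(\<lambda>\<alpha>. complex_of_real (Re c) * x \<alpha> + complex_of_real (Im c) * (\<i> * x \<alpha>)) = (\<lambda>\<alpha>. c * x \<alpha>)"
      "(\<lambda>\<alpha>. complex_of_real (- Im c) * x \<alpha> + complex_of_real (Re c) * (\<i> * x \<alpha>)) = (\<lambda>\<alpha>. \<i> * (c * x \<alpha>))"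
      by (rule ext, simp add: complex_eq_iff algebra_simps)+
    with lin[of "Re c" "Im c"] lin[of "- Im c" "Re c"]
    have "l (\<lambda>\<alpha>. c * x \<alpha>) = Re c * l x + Im c * l (\<lambda>\<alpha>. \<i> * x \<alpha>)"
      "l (\<lambda>\<alpha>. \<i> * (c * x \<alpha>)) = - Im c * l x + Re c * l (\<lambda>\<alpha>. \<i> * x \<alpha>)"
      by simp_all
    then show ?thesis
      using x by (simp add: \<phi>_def scale_mem complex_eq_iff algebra_simps)
  qed
  moreover have "cmod (\<phi> x) \<le> 2 * nrm x" if x: "x \<in> X" for x
  proof -
    have "cmod (\<phi> x) \<le> \<bar>l x\<bar> + \<bar>l (\<lambda>\<alpha>. \<i> * x \<alpha>)\<bar>"
      using cmod_le[of "\<phi> x"] x by (simp add: \<phi>_def)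
    also have "\<dots> \<le> nrm x + nrm (\<lambda>\<alpha>. \<i> * x \<alpha>)"
      by (intro add_mono bound x scale_mem)
    finally show ?thesis
      using nrm_scale[OF x, of \<i>] by simp
  qed
  ultimately have "\<phi> \<in> banach_dual X nrm"
    by (intro banach_dualI[where C = 2]) (auto simp: \<phi>_def)
  moreover have "\<phi> w = 0" if "w \<in> W" for w
    using W0[OF that] W0[OF family_subspaceD(3)[OF W(1) that]] by (simp add: \<phi>_def complex_eq_iff)
  moreover have "\<phi> v \<noteq> 0"
    using lv \<open>0 < d\<close> v by (simp add: \<phi>_def complex_eq_iff)
  ultimately show thesis by (rule that)
qed

end

section \<open>The Banach dual as a normed space\<close>

lemma banach_dualD:
  assumes "\<phi> \<in> banach_dual V nrm"
  shows "x \<in> V \<Longrightarrow> y \<in> V \<Longrightarrow> \<phi> (\<lambda>\<alpha>. x \<alpha> + y \<alpha>) = \<phi> x + \<phi> y"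
    and "x \<in> V \<Longrightarrow> \<phi> (\<lambda>\<alpha>. c * x \<alpha>) = c * \<phi> x"
    and "x \<notin> V \<Longrightarrow> \<phi> x = 0" and "\<exists>C. \<forall>x\<in>V. cmod (\<phi> x) \<le> C * nrm x"
  using assms unfolding banach_dual_def by auto

context normed_family_space
begin

lemma banach_dual_norm_bdd:
  assumes "\<phi> \<in> banach_dual X nrm"
  shows "bdd_above {cmod (\<phi> x) | x. x \<in> X \<and> nrm x \<le> 1}"
proof -
  obtain C where C: "\<And>x. x \<in> X \<Longrightarrow> cmod (\<phi> x) \<le> C * nrm x"
    using banach_dualD(4)[OF assms] by blast
  have "cmod (\<phi> x) \<le> \<bar>C\<bar>" if "x \<in> X" "nrm x \<le> 1" for x
  proof -
    have "C * nrm x \<le> \<bar>C\<bar> * 1"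
      using that nrm_nonneg by (intro mult_mono) auto
    with C[OF that(1)] show ?thesis by simp
  qed
  then show ?thesis by (auto simp: bdd_above_def)
qed

lemma banach_dual_norm_le:
  assumes "\<And>x. x \<in> X \<Longrightarrow> nrm x \<le> 1 \<Longrightarrow> cmod (\<phi> x) \<le> b"
  shows "banach_dual_norm X nrm \<phi> \<le> b"
  unfolding banach_dual_norm_def
proof (rule cSup_least)
  show "{cmod (\<phi> x) |x. x \<in> X \<and> nrm x \<le> 1} \<noteq> {}"
    using zero_mem nrm_zero by fastforce
qed (use assms in auto)

lemma cmod_le_banach_dual_norm:
  assumes "\<phi> \<in> banach_dual X nrm" "x \<in> X" "nrm x \<le> 1"
  shows "cmod (\<phi> x) \<le> banach_dual_norm X nrm \<phi>"
  unfolding banach_dual_norm_def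
  by (rule cSup_upper[OF _ banach_dual_norm_bdd[OF assms(1)]]) (use assms in auto)

lemma cmod_le_banach_dual_norm_mult:
  assumes \<phi>: "\<phi> \<in> banach_dual X nrm" and x: "x \<in> X"
  shows "cmod (\<phi> x) \<le> banach_dual_norm X nrm \<phi> * nrm x"
proof (cases "nrm x = 0")
  case True
  then show ?thesis
    using banach_dualD(2)[OF \<phi> zero_mem, of 0] x by (simp add: nrm_eq_0_iff nrm_zero)
next
  case False
  then have pos: "0 < nrm x" using nrm_nonneg[OF x] by simp
  have "cmod (\<phi> (\<lambda>\<alpha>. complex_of_real (1 / nrm x) * x \<alpha>)) \<le> banach_dual_norm X nrm \<phi>"
    using nrm_scale[OF x, of "complex_of_real (1 / nrm x)"] pos
    by (intro cmod_le_banach_dual_norm[OF \<phi>] scale_mem x) (simp add: norm_divide)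
  then show ?thesis
    using pos by (simp only: banach_dualD(2)[OF \<phi> x] norm_mult) (simp add: norm_divide field_simps)
qed

text \<open>Since the dual is again a normed space of families, the separation theorem applies to it
  as well; this is how \<open>reflexive_vanishing\<close> produces elements of the bidual.\<close>

lemma normed_family_space_banach_dual:
  "normed_family_space (banach_dual X nrm) (banach_dual_norm X nrm)"
proof
  show "(\<lambda>_. 0) \<in> banach_dual X nrm"
    by (rule banach_dualI[where C = 0]) auto
next
  fix \<phi> \<psi> assume *: "\<phi> \<in> banach_dual X nrm" "\<psi> \<in> banach_dual X nrm"
  show "(\<lambda>x. \<phi> x + \<psi> x) \<in> banach_dual X nrm"
  proof (rule banach_dualI[where C = "banach_dual_norm X nrm \<phi> + banach_dual_norm X nrm \<psi>"])
    fix x assume "x \<in> X"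
    then show "cmod (\<phi> x + \<psi> x) \<le> (banach_dual_norm X nrm \<phi> + banach_dual_norm X nrm \<psi>) * nrm x"
      unfolding distrib_right
      by (intro norm_triangle_mono cmod_le_banach_dual_norm_mult *)
  qed (use banach_dualD(1-3)[OF *(1)] banach_dualD(1-3)[OF *(2)] in \<open>auto simp: algebra_simps\<close>)
  show "banach_dual_norm X nrm (\<lambda>x. \<phi> x + \<psi> x) \<le> banach_dual_norm X nrm \<phi> + banach_dual_norm X nrm \<psi>"
    by (intro banach_dual_norm_le norm_triangle_mono cmod_le_banach_dual_norm *)
next
  fix \<phi> assume \<phi>: "\<phi> \<in> banach_dual X nrm"
  show scale: "(\<lambda>x. c * \<phi> x) \<in> banach_dual X nrm" for c
  proof (rule banach_dualI[where C = "cmod c * banach_dual_norm X nrm \<phi>"])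
    fix x assume "x \<in> X"
    then show "cmod (c * \<phi> x) \<le> cmod c * banach_dual_norm X nrm \<phi> * nrm x"
      using cmod_le_banach_dual_norm_mult[OF \<phi>] by (simp add: norm_mult mult.assoc mult_left_mono)
  qed (use banach_dualD(1-3)[OF \<phi>] in \<open>auto simp: algebra_simps\<close>)
  show nonneg: "0 \<le> banach_dual_norm X nrm \<phi>"
    using cmod_le_banach_dual_norm[OF \<phi> zero_mem] nrm_zero norm_ge_zero[of "\<phi> (\<lambda>_. 0)"] by linarith
  show "banach_dual_norm X nrm \<phi> = 0 \<longleftrightarrow> \<phi> = (\<lambda>x. 0)"
  proof
    assume "banach_dual_norm X nrm \<phi> = 0"
    then have "\<phi> x = 0" for x
      using cmod_le_banach_dual_norm_mult[OF \<phi>, of x] banach_dualD(3)[OF \<phi>, of x] by (cases "x \<in> X") auto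
    then show "\<phi> = (\<lambda>x. 0)" by blast
  next
    assume "\<phi> = (\<lambda>x. 0)"
    then have "banach_dual_norm X nrm \<phi> \<le> 0"
      by (intro banach_dual_norm_le) simp
    with nonneg show "banach_dual_norm X nrm \<phi> = 0" by simp
  qed
  have le: "banach_dual_norm X nrm (\<lambda>x. c * \<psi> x) \<le> cmod c * banach_dual_norm X nrm \<psi>"
    if "\<psi> \<in> banach_dual X nrm" for c \<psi>
    using cmod_le_banach_dual_norm[OF that]
    by (intro banach_dual_norm_le) (simp add: norm_mult mult_left_mono)
  show "banach_dual_norm X nrm (\<lambda>x. c * \<phi> x) = cmod c * banach_dual_norm X nrm \<phi>" for c
  proof (cases "c = 0")
    case True
    then show ?thesis
      using le[OF \<phi>, of 0] cmod_le_banach_dual_norm[OF scale[of 0] zero_mem] nrm_zero by simp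
  next
    case False
    then have "banach_dual_norm X nrm \<phi> \<le> cmod (1 / c) * banach_dual_norm X nrm (\<lambda>x. c * \<phi> x)"
      using le[OF scale, of "1 / c" c] by simp
    then show ?thesis
      using le[OF \<phi>, of c] False by (simp add: norm_divide field_simps)
  qed
qed

end

section \<open>Backward shift operators on families vanishing at infinity\<close>

text \<open>The space c_0 over an arbitrary index set, expressed by finite superlevel sets because
  the index monoid carries no order.\<close>

definition vanishing :: "('i \<Rightarrow> complex) \<Rightarrow> bool"
  where "vanishing y \<longleftrightarrow> (\<forall>e>0. finite {\<alpha>. e \<le> cmod (y \<alpha>)})"

lemma vanishing_zero: "vanishing (\<lambda>_. 0)"
  by (simp add: vanishing_def not_le)

lemma vanishing_add:
  assumes "vanishing x" "vanishing y"
  shows "vanishing (\<lambda>\<alpha>. x \<alpha> + y \<alpha>)"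
  unfolding vanishing_def
proof (intro allI impI)
  fix e :: real assume "0 < e"
  have "{\<alpha>. e \<le> cmod (x \<alpha> + y \<alpha>)} \<subseteq> {\<alpha>. e / 2 \<le> cmod (x \<alpha>)} \<union> {\<alpha>. e / 2 \<le> cmod (y \<alpha>)}"
  proof
    fix \<alpha> assume "\<alpha> \<in> {\<alpha>. e \<le> cmod (x \<alpha> + y \<alpha>)}"
    with norm_triangle_ineq[of "x \<alpha>" "y \<alpha>"]
    show "\<alpha> \<in> {\<alpha>. e / 2 \<le> cmod (x \<alpha>)} \<union> {\<alpha>. e / 2 \<le> cmod (y \<alpha>)}" by auto
  qed
  then show "finite {\<alpha>. e \<le> cmod (x \<alpha> + y \<alpha>)}"
    using assms \<open>0 < e\<close> unfolding vanishing_def by (meson finite_UnI finite_subset half_gt_zero)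
qed

lemma vanishing_cmult:
  assumes "vanishing x"
  shows "vanishing (\<lambda>\<alpha>. c * x \<alpha>)"
proof (cases "c = 0")
  case False
  have "{\<alpha>. e \<le> cmod (c * x \<alpha>)} = {\<alpha>. e / cmod c \<le> cmod (x \<alpha>)}" for e
    using False by (simp add: norm_mult field_simps)
  then show ?thesis
    using assms False by (simp add: vanishing_def)
qed (simp add: vanishing_zero)

lemma vanishing_sum:
  assumes "\<And>i. i \<in> I \<Longrightarrow> vanishing (f i)"
  shows "vanishing (\<lambda>\<alpha>. \<Sum>i\<in>I. f i \<alpha>)"
  using assms
  by (induction I rule: infinite_finite_induct) (simp_all add: vanishing_zero vanishing_add)

text \<open>Cancellation makes translation injective, so preimages of finite superlevel sets are
  finite.\<close>

lemma vanishing_translate: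
  fixes y :: "'i::cancel_comm_monoid_add \<Rightarrow> complex"
  assumes "vanishing y"
  shows "vanishing (\<lambda>\<beta>. y (\<alpha> + \<beta>))"
  unfolding vanishing_def
proof (intro allI impI)
  fix e :: real assume "0 < e"
  then have "finite ((+) \<alpha> -` {\<beta>. e \<le> cmod (y \<beta>)})"
    using assms by (intro finite_vimageI) (auto simp: vanishing_def)
  then show "finite {\<beta>. e \<le> cmod (y (\<alpha> + \<beta>))}"
    by (simp add: vimage_def)
qed

text \<open>A maximum principle: \<open>\<bar>u\<bar>\<close> attains its maximum on a finite set only.\<close>

lemma vanishing_eq_0:
  fixes h :: "'i \<Rightarrow> nat"
  assumes "vanishing u"
    and step: "\<And>\<beta>. u \<beta> \<noteq> 0 \<Longrightarrow> \<exists>\<beta>'. h \<beta> < h \<beta>' \<and> cmod (u \<beta>) \<le> cmod (u \<beta>')"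
  shows "u \<beta> = 0"
proof (rule ccontr)
  assume "u \<beta> \<noteq> 0"
  \<comment> \<open>This superlevel set is finite and closed under the passage from an index to the
    one supplied by \<open>step\<close>, so an element of maximal height gives a
    contradiction.\<close>
  let ?S = "{\<alpha>. cmod (u \<beta>) \<le> cmod (u \<alpha>)}"
  have "finite ?S"
    using assms(1) \<open>u \<beta> \<noteq> 0\<close> by (simp add: vanishing_def)
  moreover have "?S \<noteq> {}" by blast
  ultimately have "Max (h ` ?S) \<in> h ` ?S"
    by (intro Max_in) auto
  then obtain \<gamma> where "\<gamma> \<in> ?S" "Max (h ` ?S) = h \<gamma>" by blast
  then have \<gamma>: "\<gamma> \<in> ?S" "\<forall>\<alpha>\<in>?S. h \<alpha> \<le> h \<gamma>"
    using \<open>finite ?S\<close> by (auto intro: Max_ge simp flip: \<open>Max (h ` ?S) = h \<gamma>\<close>)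
  then have "u \<gamma> \<noteq> 0"
    using \<open>u \<beta> \<noteq> 0\<close> by auto
  from step[OF this] obtain \<gamma>' where "h \<gamma> < h \<gamma>'" "cmod (u \<gamma>) \<le> cmod (u \<gamma>')" by blast
  with \<gamma> show False
    by (metis (mono_tags, lifting) leD mem_Collect_eq order_trans)
qed

text \<open>\<open>backward f\<close> is \<open>f(S\<^sup>*)\<close>, where \<open>S\<^sup>*\<close> consists of the backward shifts.\<close>

definition backward :: "('i::cancel_comm_monoid_add \<Rightarrow> complex) \<Rightarrow> ('i \<Rightarrow> complex) \<Rightarrow> 'i \<Rightarrow> complex"
  where "backward f y \<beta> = (\<Sum>\<alpha> | f \<alpha> \<noteq> 0. f \<alpha> * y (\<alpha> + \<beta>))"

lemma backward_eq_sum: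
  assumes "finite S" "{\<alpha>. f \<alpha> \<noteq> 0} \<subseteq> S"
  shows "backward f y \<beta> = (\<Sum>\<alpha>\<in>S. f \<alpha> * y (\<alpha> + \<beta>))"
  unfolding backward_def by (rule sum.mono_neutral_left) (use assms in auto)

lemma vanishing_backward: "vanishing y \<Longrightarrow> vanishing (backward f y)"
  unfolding backward_def[abs_def]
  by (intro vanishing_sum vanishing_cmult vanishing_translate)

lemma backward_add:
  assumes "finite {\<alpha>. f \<alpha> \<noteq> 0}" "finite {\<alpha>. g \<alpha> \<noteq> 0}"
  shows "backward (\<lambda>\<alpha>. f \<alpha> + g \<alpha>) y \<beta> = backward f y \<beta> + backward g y \<beta>"
proof -
  let ?S = "{\<alpha>. f \<alpha> \<noteq> 0} \<union> {\<alpha>. g \<alpha> \<noteq> 0}"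
  have "backward h y \<beta> = (\<Sum>\<alpha>\<in>?S. h \<alpha> * y (\<alpha> + \<beta>))" if "h \<in> {f, g, \<lambda>\<alpha>. f \<alpha> + g \<alpha>}" for h
    by (rule backward_eq_sum) (use assms that in auto)
  then show ?thesis
    by (simp add: sum.distrib algebra_simps)
qed

lemma backward_cmult:
  assumes "finite {\<alpha>. f \<alpha> \<noteq> 0}"
  shows "backward (\<lambda>\<alpha>. c * f \<alpha>) y \<beta> = c * backward f y \<beta>"
  using backward_eq_sum[OF assms, of "\<lambda>\<alpha>. c * f \<alpha>"] backward_eq_sum[OF assms, of f]
  by (auto simp: sum_distrib_left mult.assoc)

lemma shift_add [simp]: "shift \<gamma> f (\<alpha> + \<gamma>) = f \<alpha>"
  by (auto simp: shift_def)

lemma shift_support: "{\<alpha>. shift \<gamma> f \<alpha> \<noteq> 0} = (\<lambda>\<alpha>. \<alpha> + \<gamma>) ` {\<alpha>. f \<alpha> \<noteq> 0}"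
proof -
  have "\<exists>\<beta>. \<alpha> = \<beta> + \<gamma>" if "shift \<gamma> f \<alpha> \<noteq> 0" for \<alpha>
    using that by (auto simp: shift_def split: if_splits)
  then show ?thesis by fastforce
qed

text \<open>Multiplying the symbol by a monomial translates the result; this is why products of
  polynomials become compositions of their operators.\<close>

lemma backward_shift: "backward (shift \<gamma> f) y \<beta> = backward f y (\<gamma> + \<beta>)"
  unfolding backward_def shift_support
  by (subst sum.reindex) (auto simp: inj_on_def add.assoc)

lemma pairing_finite_support:
  assumes "finite {\<alpha>. f \<alpha> \<noteq> 0}"
  shows "pairing f y = (\<Sum>\<alpha> | f \<alpha> \<noteq> 0. f \<alpha> * y \<alpha>)"
proof -
  have "pairing f y = (\<Sum>\<^sub>\<infinity>\<alpha>\<in>{\<alpha>. f \<alpha> \<noteq> 0}. f \<alpha> * y \<alpha>)"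
    unfolding pairing_def by (rule infsum_cong_neutral) auto
  then show ?thesis using assms by simp
qed

text \<open>The duality behind the proof: y annihilates all monomial multiples of \<open>f\<close>
  exactly when \<open>backward f y\<close> vanishes identically.\<close>

lemma pairing_shift:
  assumes "finite {\<alpha>. f \<alpha> \<noteq> 0}"
  shows "pairing (shift \<beta> f) y = backward f y \<beta>"
proof -
  have "finite {\<alpha>. shift \<beta> f \<alpha> \<noteq> 0}"
    using assms by (simp add: shift_support)
  then have "pairing (shift \<beta> f) y = backward (shift \<beta> f) y 0"
    by (simp add: pairing_finite_support backward_def)
  then show ?thesis by (simp add: backward_shift)
qed

text \<open>The operator is linear in y, so injectivity is triviality of its kernel; the domain is
  c_0.\<close>

definition backward_injective :: "('i::cancel_comm_monoid_add \<Rightarrow> complex) \<Rightarrow> bool"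
  where "backward_injective f \<longleftrightarrow>
    (\<forall>y. vanishing y \<longrightarrow> (\<forall>\<beta>. backward f y \<beta> = 0) \<longrightarrow> (\<forall>\<beta>. y \<beta> = 0))"

lemma lookup_single_mult:
  fixes q :: "'i::cancel_comm_monoid_add \<Rightarrow>\<^sub>0 complex"
  shows "Poly_Mapping.lookup (Poly_Mapping.single \<gamma> c * q) = (\<lambda>\<alpha>. c * shift \<gamma> (Poly_Mapping.lookup q) \<alpha>)"
proof
  fix k
  have "Poly_Mapping.lookup (Poly_Mapping.single \<gamma> c * q) k
      = (\<Sum>l. c * (\<Sum>r. Poly_Mapping.lookup q r when k = l + r) when l = \<gamma>)"
    unfolding lookup_mult lookup_single by (intro Sum_any.cong) (simp add: when_def)
  also have "\<dots> = c * (\<Sum>r. Poly_Mapping.lookup q r when k = \<gamma> + r)"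
    by simp
  also have "(\<Sum>r. Poly_Mapping.lookup q r when k = \<gamma> + r) = shift \<gamma> (Poly_Mapping.lookup q) k"
  proof (cases "\<exists>\<alpha>. k = \<alpha> + \<gamma>")
    case True
    then obtain \<alpha> where "k = \<alpha> + \<gamma>" ..
    then have "(\<Sum>r. Poly_Mapping.lookup q r when k = \<gamma> + r) = (\<Sum>r. Poly_Mapping.lookup q r when r = \<alpha>)"
      by (intro Sum_any.cong) (auto simp: when_def add.commute)
    then show ?thesis
      by (simp add: \<open>k = \<alpha> + \<gamma>\<close>)
  next
    case False
    then have "(Poly_Mapping.lookup q r when k = \<gamma> + r) = 0" for r
      by (auto simp: when_def add.commute[of \<gamma>])
    with False show ?thesis
      by (simp add: shift_def)
  qed
  finally show "Poly_Mapping.lookup (Poly_Mapping.single \<gamma> c * q) k = c * shift \<gamma> (Poly_Mapping.lookup q) k" .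
qed

lemma backward_lookup_add:
  "backward (Poly_Mapping.lookup (p + q)) y \<beta>
    = backward (Poly_Mapping.lookup p) y \<beta> + backward (Poly_Mapping.lookup q) y \<beta>"
  using backward_add[OF finite_lookup finite_lookup] by (simp add: lookup_add[abs_def] plus_poly_mapping.rep_eq)

lemma backward_lookup_sum:
  "backward (Poly_Mapping.lookup (\<Sum>i\<in>I. p i)) y \<beta> = (\<Sum>i\<in>I. backward (Poly_Mapping.lookup (p i)) y \<beta>)"
proof -
  have "backward (Poly_Mapping.lookup 0) y \<beta> = 0"
    by (simp add: backward_def)
  then show ?thesis
    by (induction I rule: infinite_finite_induct) (simp_all add: backward_lookup_add)
qed

lemma backward_single_mult:
  "backward (Poly_Mapping.lookup (Poly_Mapping.single \<gamma> c * q)) y \<beta>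
    = c * backward (Poly_Mapping.lookup q) y (\<gamma> + \<beta>)"
proof -
  have "finite {\<alpha>. shift \<gamma> (Poly_Mapping.lookup q) \<alpha> \<noteq> 0}"
    by (simp add: shift_support)
  then show ?thesis
    by (simp add: lookup_single_mult backward_cmult backward_shift)
qed

section \<open>Linearly factorable polynomials\<close>

text \<open>The affine factor acts last: for u = \<open>backward (Poly_Mapping.lookup q) y\<close>
  the kernel equation of the product becomes a recurrence linking u at \<beta> to u at the
  neighbours of \<beta> one degree higher.\<close>

lemma backward_affine_mult:
  fixes q :: "nat ^ 'n \<Rightarrow>\<^sub>0 complex"
  shows "backward (Poly_Mapping.lookup
      ((Poly_Mapping.single 0 a + (\<Sum>i\<in>UNIV. Poly_Mapping.single (axis i 1) (c i))) * q)) y \<beta>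
    = a * backward (Poly_Mapping.lookup q) y \<beta>
      + (\<Sum>i\<in>UNIV. c i * backward (Poly_Mapping.lookup q) y (axis i 1 + \<beta>))"
  by (simp add: distrib_right sum_distrib_right backward_lookup_add backward_lookup_sum
      backward_single_mult)

text \<open>The family of monomial values at \<zeta> is a joint eigenvector of the backward shifts,
  with the coordinates of \<zeta> as eigenvalues. Hence multiplicativity of evaluation is an
  instance of \<open>backward_affine_mult\<close>.\<close>

lemma mpoly_eval_eq_backward:
  "mpoly_eval f \<zeta> = backward (Poly_Mapping.lookup f) (\<lambda>\<alpha>. \<Prod>i\<in>UNIV. (\<zeta> $ i) ^ (\<alpha> $ i)) 0"
  by (simp add: mpoly_eval_def backward_def Poly_Mapping.keys.rep_eq)

lemma mpoly_eval_affine_mult: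
  "mpoly_eval ((Poly_Mapping.single 0 a + (\<Sum>i\<in>UNIV. Poly_Mapping.single (axis i 1) (c i))) * q) \<zeta>
    = (a + (\<Sum>i\<in>UNIV. c i * \<zeta> $ i)) * mpoly_eval q \<zeta>"
proof -
  define m where "m \<alpha> = (\<Prod>i\<in>UNIV. (\<zeta> $ i) ^ (\<alpha> $ i))" for \<alpha>
  have "backward (Poly_Mapping.lookup q) m (axis i 1) = \<zeta> $ i * backward (Poly_Mapping.lookup q) m 0" for i
  proof -
    have "m (\<alpha> + axis i 1) = \<zeta> $ i * m \<alpha>" for \<alpha>
    proof -
      have "m (\<alpha> + axis i 1) = (\<Prod>j\<in>UNIV. (\<zeta> $ j) ^ (\<alpha> $ j) * (if j = i then \<zeta> $ i else 1))"
        unfolding m_def by (intro prod.cong) (auto simp: axis_def power_add)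
      then show ?thesis
        by (simp add: m_def prod.distrib)
    qed
    then show ?thesis
      by (simp add: backward_def sum_distrib_left mult.left_commute)
  qed
  then show ?thesis
    unfolding mpoly_eval_eq_backward m_def[symmetric, abs_def] backward_affine_mult
    by (simp add: distrib_right sum_distrib_right mult.assoc)
qed

lemma mult_cnj_sgn: "z * cnj (sgn z) = complex_of_real (cmod z)"
  by (cases "z = 0") (simp_all add: sgn_div_norm scaleR_conv_of_real complex_norm_square[symmetric]
      power2_eq_square field_simps)

lemma affine_no_zero_imp_dominant:
  fixes c :: "'n::finite \<Rightarrow> complex"
  assumes "\<And>\<zeta>. \<zeta> \<in> polydisc \<Longrightarrow> a + (\<Sum>i\<in>UNIV. c i * \<zeta> $ i) \<noteq> 0"
  shows "a \<noteq> 0" "(\<Sum>i\<in>UNIV. cmod (c i)) \<le> cmod a"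
proof -
  show "a \<noteq> 0"
    using assms[of 0] by (simp add: polydisc_def)
  show "(\<Sum>i\<in>UNIV. cmod (c i)) \<le> cmod a" (is "?s \<le> _")
  proof (rule ccontr)
    define s where "s = ?s"
    assume "\<not> ?s \<le> cmod a"
    then have less: "cmod a < s" by (simp add: s_def)
    then have s: "0 < s" using norm_ge_zero[of a] by linarith
    \<comment> \<open>The phase of each coordinate turns \<open>c i * \<zeta> $ i\<close> into the
      direction of - a, and division by \<open>s\<close> makes the total equal to - a. Each modulus
      is at most \<open>cmod a / s\<close>, which is below 1; it is 0 where \<open>c i\<close> is
      0.\<close>
    define \<zeta> :: "complex ^ 'n" where "\<zeta> = (\<chi> i. - a * cnj (sgn (c i)) / complex_of_real s)"
    have "cmod (\<zeta> $ i) < 1" for i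
    proof -
      have "cmod (\<zeta> $ i) \<le> cmod a / s"
        using s by (simp add: \<zeta>_def norm_divide norm_mult norm_sgn divide_right_mono)
      also have "\<dots> < 1" using less s by simp
      finally show ?thesis .
    qed
    then have "\<zeta> \<in> polydisc" by (simp add: polydisc_def)
    moreover have "c i * \<zeta> $ i = - a * (complex_of_real (cmod (c i)) / complex_of_real s)" for i
    proof -
      show ?thesis
        using mult_cnj_sgn[of "c i"] by (simp add: \<zeta>_def mult.left_commute)
    qed
    then have "(\<Sum>i\<in>UNIV. c i * \<zeta> $ i) = - a * ((\<Sum>i\<in>UNIV. complex_of_real (cmod (c i))) / complex_of_real s)"
      by (simp add: sum_negf sum_distrib_left sum_divide_distrib)
    then have "(\<Sum>i\<in>UNIV. c i * \<zeta> $ i) = - a"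
      using s by (simp add: s_def flip: of_real_sum)
    ultimately show False using assms[of \<zeta>] by simp
  qed
qed

text \<open>The equation writes u at \<beta> as a combination of its neighbours with weights of
  total modulus at most 1, so some neighbour is at least as large. Total degree serves as the height
  in the maximum principle.\<close>

lemma dominant_eq_0:
  fixes u :: "nat ^ 'n \<Rightarrow> complex"
  assumes "vanishing u" and a: "a \<noteq> 0" and c: "(\<Sum>i\<in>UNIV. cmod (c i)) \<le> cmod a"
    and eq: "\<And>\<beta>. a * u \<beta> + (\<Sum>i\<in>UNIV. c i * u (axis i 1 + \<beta>)) = 0"
  shows "u \<beta> = 0"
proof (rule vanishing_eq_0[OF assms(1), where h = "\<lambda>\<alpha>. \<Sum>i\<in>UNIV. \<alpha> $ i"])
  fix \<beta> assume "u \<beta> \<noteq> 0"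
  have "\<exists>i. cmod (u \<beta>) \<le> cmod (u (axis i 1 + \<beta>))"
  proof (rule ccontr)
    assume "\<not> ?thesis"
    then have less: "cmod (u (axis i 1 + \<beta>)) < cmod (u \<beta>)" for i
      by (auto simp: not_le)
    have "cmod a * cmod (u \<beta>) = cmod (\<Sum>i\<in>UNIV. c i * u (axis i 1 + \<beta>))"
      using eq[of \<beta>] by (metis add_eq_0_iff norm_minus_cancel norm_mult)
    also have "\<dots> \<le> (\<Sum>i\<in>UNIV. cmod (c i) * cmod (u (axis i 1 + \<beta>)))"
      by (rule order_trans[OF norm_sum]) (simp add: norm_mult)
    finally have le: "cmod a * cmod (u \<beta>) \<le> (\<Sum>i\<in>UNIV. cmod (c i) * cmod (u (axis i 1 + \<beta>)))" .
    show False
    \<comment> \<open>Strictness of the estimate needs one nonzero coefficient; otherwise the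
      equation reduces to \<open>a * u \<beta> = 0\<close>.\<close>
    proof (cases "\<forall>i. c i = 0")
      case True
      then show False using le a \<open>u \<beta> \<noteq> 0\<close> by (auto simp: mult_le_0_iff)
    next
      case False
      then obtain i where "c i \<noteq> 0" by blast
      then have "cmod (c i) * cmod (u (axis i 1 + \<beta>)) < cmod (c i) * cmod (u \<beta>)"
        by (intro mult_strict_left_mono less) simp
      then have "(\<Sum>i\<in>UNIV. cmod (c i) * cmod (u (axis i 1 + \<beta>))) < (\<Sum>i\<in>UNIV. cmod (c i) * cmod (u \<beta>))"
        by (intro sum_strict_mono_ex1 finite ballI mult_left_mono less_imp_le[OF less]) auto
      also have "\<dots> \<le> cmod a * cmod (u \<beta>)"
        unfolding sum_distrib_right[symmetric] by (rule mult_right_mono[OF c]) simp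
      finally show False using le by simp
    qed
  qed
  then obtain i where "cmod (u \<beta>) \<le> cmod (u (axis i 1 + \<beta>))" ..
  moreover have "(\<Sum>j\<in>UNIV. \<beta> $ j) < (\<Sum>j\<in>UNIV. (axis i 1 + \<beta>) $ j)"
    by (simp add: sum.distrib axis_def)
  ultimately show "\<exists>\<beta>'. (\<Sum>j\<in>UNIV. \<beta> $ j) < (\<Sum>j\<in>UNIV. \<beta>' $ j) \<and> cmod (u \<beta>) \<le> cmod (u \<beta>')"
    by blast
qed

text \<open>One factor is split off at a time. What remains, \<open>q\<close>, has no zeros in the
  polydisc either, and \<open>backward\<close> of \<open>q\<close> applied to y again vanishes at
  infinity, so the affine factor forces it to be 0 and the induction hypothesis applies to
  y.\<close>

lemma backward_injective_linearly_factorable: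
  fixes f :: "nat ^ 'n \<Rightarrow>\<^sub>0 complex"
  assumes "linearly_factorable f" and "\<And>\<zeta>. \<zeta> \<in> polydisc \<Longrightarrow> mpoly_eval f \<zeta> \<noteq> 0"
  shows "backward_injective (Poly_Mapping.lookup f)"
proof -
  obtain n :: nat and g where g: "\<forall>j\<in>{1..n}. affine_linear (g j)" "f = (\<Prod>j\<in>{1..n}. g j)"
    using assms(1) unfolding linearly_factorable_def by blast
  from g assms(2) show ?thesis
  proof (induction n arbitrary: f)
    case 0
    then have "backward (Poly_Mapping.lookup f) y \<beta> = y \<beta>" for y \<beta>
      using backward_single_mult[of 0 1 1 y \<beta>] by (simp add: backward_def lookup_one)
    then show ?case by (simp add: backward_injective_def)
  next
    case (Suc n)
    define q where "q = (\<Prod>j\<in>{1..n}. g j)"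
    obtain a c where gn: "g (Suc n) = Poly_Mapping.single 0 a + (\<Sum>i\<in>UNIV. Poly_Mapping.single (axis i 1) (c i))"
      using Suc.prems(1) unfolding affine_linear_def by fastforce
    have f: "f = (Poly_Mapping.single 0 a + (\<Sum>i\<in>UNIV. Poly_Mapping.single (axis i 1) (c i))) * q"
      using Suc.prems(2) by (simp add: q_def gn mult.commute)
    have nz: "a + (\<Sum>i\<in>UNIV. c i * \<zeta> $ i) \<noteq> 0" "mpoly_eval q \<zeta> \<noteq> 0" if "\<zeta> \<in> polydisc" for \<zeta>
      using Suc.prems(3)[OF that, unfolded f mpoly_eval_affine_mult] by auto
    note dom = affine_no_zero_imp_dominant[OF nz(1)]
    have "backward_injective (Poly_Mapping.lookup q)"
      by (rule Suc.IH) (use Suc.prems(1) nz(2) q_def in auto)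
    moreover have "backward (Poly_Mapping.lookup q) y \<beta> = 0"
      if y: "vanishing y" "\<forall>\<beta>. backward (Poly_Mapping.lookup f) y \<beta> = 0" for y \<beta>
      by (rule dominant_eq_0[OF vanishing_backward[OF y(1)] dom])
        (use y(2)[unfolded f backward_affine_mult] in blast)+
    ultimately show ?case
      unfolding backward_injective_def by blast
  qed
qed

section \<open>Polynomials in one variable\<close>

lemma finite_coeff: "finite {n. coeff p n \<noteq> (0 :: complex)}"
  using MOST_coeff_eq_0[of p] by (simp add: MOST_iff_cofinite)

lemma backward_linear_factor_mult:
  "backward (coeff ([:a, 1:] * p)) y n = a * backward (coeff p) y n + backward (coeff p) y (Suc n)"
proof -
  have "coeff ([:a, 1:] * p) = (\<lambda>n. a * coeff p n + shift 1 (coeff p) n)"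
  proof
    fix n show "coeff ([:a, 1:] * p) n = a * coeff p n + shift 1 (coeff p) n"
      by (cases n) (auto simp: shift_def)
  qed
  then have "backward (coeff ([:a, 1:] * p)) y n = backward (\<lambda>n. a * coeff p n) y n + backward (shift 1 (coeff p)) y n"
    using finite_coeff[of p] finite_coeff[of "smult a p"]
    by (simp only:) (rule backward_add, simp_all add: shift_support)
  then show ?thesis
    using backward_cmult[OF finite_coeff] by (simp add: backward_shift)
qed

text \<open>In one variable every polynomial splits into linear factors. A root r has modulus at
  least 1, and its factor gives the recurrence u(n + 1) = r u(n), along which the modulus cannot
  decrease.\<close>

lemma backward_injective_coeff:
  fixes f :: "complex poly"
  assumes "\<And>\<zeta>. cmod \<zeta> < 1 \<Longrightarrow> poly f \<zeta> \<noteq> 0"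
  shows "backward_injective (coeff f)"
  using assms
proof (induction "degree f" arbitrary: f)
  case 0
  then obtain c where c: "f = [:c:]" using degree_eq_zeroE by metis
  then have "c \<noteq> 0" using "0.prems"[of 0] by simp
  have "{n. coeff [:c:] n \<noteq> 0} = {0}"
    using \<open>c \<noteq> 0\<close> by (auto simp: coeff_pCons split: nat.splits intro: ccontr dest: not0_implies_Suc)
  then have "backward (coeff f) y n = c * y n" for y n
    by (simp add: c backward_def)
  with \<open>c \<noteq> 0\<close> show ?case by (simp add: backward_injective_def)
next
  case (Suc d)
  then have "\<not> constant (poly f)" by (simp add: constant_degree)
  then obtain r where r: "poly f r = 0" using fundamental_theorem_of_algebra by blast
  then obtain q where f: "f = [:- r, 1:] * q" by (auto simp: poly_eq_0_iff_dvd)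
  have "1 \<le> cmod r" using Suc.prems[of r] r by force
  have "q \<noteq> 0" using Suc.hyps(2) by (auto simp: f)
  then have "d = degree q" 
    using Suc.hyps(2) degree_mult_eq[of "[:- r, 1:]" q] by (simp add: f del: mult_pCons_left)
  then have "backward_injective (coeff q)"
    by (rule Suc.hyps(1)) (use Suc.prems in \<open>auto simp: f\<close>)
  moreover have "backward (coeff q) y n = 0"
    if y: "vanishing y" "\<forall>n. backward (coeff f) y n = 0" for y n
  proof (rule vanishing_eq_0[OF vanishing_backward[OF y(1)], where h = "\<lambda>n. n"])
    fix n
    have "backward (coeff q) y (Suc n) = r * backward (coeff q) y n"
      using y(2)[rule_format, of n] by (simp only: f backward_linear_factor_mult) simp
    then have "cmod (backward (coeff q) y n) \<le> cmod (backward (coeff q) y (Suc n))"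
      using \<open>1 \<le> cmod r\<close> mult_right_mono[of 1 "cmod r" "cmod (backward (coeff q) y n)"]
      by (simp add: norm_mult)
    then show "\<exists>m>n. cmod (backward (coeff q) y n) \<le> cmod (backward (coeff q) y m)" by blast
  qed
  ultimately show ?case
    unfolding backward_injective_def by blast
qed

section \<open>Families with finite support and polynomial multiples\<close>

lemma unit_family_support: "{\<alpha>. unit_family \<beta> \<alpha> \<noteq> 0} = {\<beta>}"
  by (auto simp: unit_family_def)

lemma shift_unit_family: "shift \<alpha> (unit_family 0) = unit_family \<alpha>"
proof
  fix \<gamma> show "shift \<alpha> (unit_family 0) \<gamma> = unit_family \<alpha> \<gamma>"
  proof (cases "\<exists>\<beta>. \<gamma> = \<beta> + \<alpha>")
    case True
    then obtain \<beta> where "\<gamma> = \<beta> + \<alpha>" ..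
    then show ?thesis by (simp add: unit_family_def)
  next
    case False
    then have "\<gamma> \<noteq> \<alpha>" by (metis add_0)
    with False show ?thesis by (simp add: shift_def unit_family_def)
  qed
qed

lemma family_subspace_sum:
  assumes "family_subspace W" "\<And>i. i \<in> I \<Longrightarrow> f i \<in> W"
  shows "(\<lambda>\<alpha>. \<Sum>i\<in>I. f i \<alpha>) \<in> W"
  using assms(2)
  by (induction I rule: infinite_finite_induct) (simp_all add: family_subspaceD[OF assms(1)])

lemma family_eq_sum_unit_family:
  assumes "finite {\<alpha>. f \<alpha> \<noteq> 0}"
  shows "f = (\<lambda>\<beta>. \<Sum>\<alpha> | f \<alpha> \<noteq> 0. f \<alpha> * unit_family \<alpha> \<beta>)"
proof
  fix \<beta>
  have "(\<Sum>\<alpha> | f \<alpha> \<noteq> 0. f \<alpha> * unit_family \<alpha> \<beta>) = (\<Sum>\<alpha> | f \<alpha> \<noteq> 0. if \<alpha> = \<beta> then f \<beta> else 0)"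
    by (intro sum.cong) (auto simp: unit_family_def)
  then show "f \<beta> = (\<Sum>\<alpha> | f \<alpha> \<noteq> 0. f \<alpha> * unit_family \<alpha> \<beta>)"
    using assms by auto
qed

lemma finite_support_mem:
  assumes "family_subspace W" "\<And>\<alpha>. unit_family \<alpha> \<in> W" "finite {\<alpha>. f \<alpha> \<noteq> 0}"
  shows "f \<in> W"
  by (subst family_eq_sum_unit_family[OF assms(3)])
    (intro family_subspace_sum family_subspaceD(3) assms(1,2))

text \<open>For fixed \<gamma> the product is read as an operator with symbol \<open>p\<close>, so
  that linearity in \<open>p\<close> is inherited from \<open>backward\<close>.\<close>

lemma poly_times_eq_backward:
  "poly_times p f \<gamma> = backward (Poly_Mapping.lookup p) (\<lambda>\<beta>. shift \<beta> f \<gamma>) 0"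
  by (simp add: poly_times_def backward_def Poly_Mapping.keys.rep_eq)

lemma poly_times_single: "poly_times (Poly_Mapping.single \<beta> 1) f = shift \<beta> f"
  by (simp add: poly_times_def)

lemma family_subspace_poly_times: "family_subspace {poly_times p f | p. True}"
proof -
  have "poly_times p f \<gamma> + poly_times q f \<gamma> = poly_times (p + q) f \<gamma>" for p q \<gamma>
    by (simp add: poly_times_eq_backward backward_lookup_add)
  then have "(\<lambda>\<gamma>. poly_times p f \<gamma> + poly_times q f \<gamma>) = poly_times (p + q) f" for p q
    by blast
  moreover have "(\<lambda>\<gamma>. c * poly_times p f \<gamma>) = poly_times (Poly_Mapping.single 0 c * p) f" for c p
    by (simp add: poly_times_eq_backward[abs_def] backward_single_mult)
  moreover have "(\<lambda>_. 0) = poly_times 0 f"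
    by (simp add: poly_times_def)
  ultimately show ?thesis
    unfolding family_subspace_def by auto
qed

lemma poly_times_mem:
  assumes "family_subspace W" "\<And>\<alpha>. unit_family \<alpha> \<in> W" "finite {\<alpha>. f \<alpha> \<noteq> 0}"
  shows "poly_times p f \<in> W"
  unfolding poly_times_def
  by (intro family_subspace_sum family_subspaceD(3) finite_support_mem[OF assms(1,2)] assms(1))
    (simp add: shift_support assms(3))

section \<open>Pairings and weak density\<close>

lemma seq_dualD: "y \<in> seq_dual X \<Longrightarrow> x \<in> X \<Longrightarrow> (\<lambda>\<alpha>. cmod (x \<alpha> * y \<alpha>)) summable_on UNIV"
  by (simp add: seq_dual_def)

lemma seq_dual_summable: "y \<in> seq_dual X \<Longrightarrow> x \<in> X \<Longrightarrow> (\<lambda>\<alpha>. x \<alpha> * y \<alpha>) summable_on UNIV"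
  by (rule abs_summable_summable) (rule seq_dualD)

lemma family_subspace_seq_dual: "family_subspace (seq_dual X)"
  unfolding family_subspace_def
proof (intro conjI ballI allI)
  show "(\<lambda>_. 0) \<in> seq_dual X" by (simp add: seq_dual_def)
  fix y assume y: "y \<in> seq_dual X"
  show "(\<lambda>\<alpha>. c * y \<alpha>) \<in> seq_dual X" for c
    using summable_on_cmult_right[OF seq_dualD[OF y], of _ "cmod c"]
    by (simp add: seq_dual_def norm_mult mult.left_commute)
  fix z assume z: "z \<in> seq_dual X"
  show "(\<lambda>\<alpha>. y \<alpha> + z \<alpha>) \<in> seq_dual X"
    unfolding seq_dual_def
  proof (intro CollectI ballI)
    fix x assume x: "x \<in> X"
    show "(\<lambda>\<alpha>. cmod (x \<alpha> * (y \<alpha> + z \<alpha>))) summable_on UNIV"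
      by (rule Infinite_Sum.abs_summable_on_comparison_test'[OF summable_on_add[OF seq_dualD[OF y x] seq_dualD[OF z x]]])
        (simp add: distrib_left norm_triangle_ineq)
  qed
qed

lemma pairing_add_left:
  assumes "y \<in> seq_dual X" "x \<in> X" "x' \<in> X"
  shows "pairing (\<lambda>\<alpha>. x \<alpha> + x' \<alpha>) y = pairing x y + pairing x' y"
  using infsum_add[OF seq_dual_summable[OF assms(1,2)] seq_dual_summable[OF assms(1,3)]]
  by (simp add: pairing_def distrib_right)

lemma pairing_add_right:
  assumes "y \<in> seq_dual X" "y' \<in> seq_dual X" "x \<in> X"
  shows "pairing x (\<lambda>\<alpha>. y \<alpha> + y' \<alpha>) = pairing x y + pairing x y'"
  using infsum_add[OF seq_dual_summable[OF assms(1,3)] seq_dual_summable[OF assms(2,3)]]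
  by (simp add: pairing_def distrib_left)

lemma pairing_cmult_left: "pairing (\<lambda>\<alpha>. c * x \<alpha>) y = c * pairing x y"
  by (simp add: pairing_def mult.assoc infsum_cmult_right')

lemma pairing_cmult_right: "pairing x (\<lambda>\<alpha>. c * y \<alpha>) = c * pairing x y"
  by (simp add: pairing_def mult.left_commute infsum_cmult_right')

lemma pairing_diff_left:
  assumes "family_subspace X" "y \<in> seq_dual X" "x \<in> X" "x' \<in> X"
  shows "pairing (\<lambda>\<alpha>. x \<alpha> - x' \<alpha>) y = pairing x y - pairing x' y"
  using pairing_add_left[OF assms(2,3) family_subspace_uminus[OF assms(1,4)]]
    pairing_cmult_left[of "-1" x' y] by simp

lemma pairing_diff_right:
  assumes "y \<in> seq_dual X" "y' \<in> seq_dual X" "x \<in> X"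
  shows "pairing x (\<lambda>\<alpha>. y \<alpha> - y' \<alpha>) = pairing x y - pairing x y'"
  using pairing_add_right[OF assms(1) family_subspace_uminus[OF family_subspace_seq_dual assms(2)] assms(3)]
    pairing_cmult_right[of x "-1" y'] by simp

lemma pairing_unit_family: "pairing (unit_family \<alpha>) y = y \<alpha>"
  by (subst pairing_finite_support) (simp_all add: unit_family_support, simp add: unit_family_def)

text \<open>
  A projection \<open>P\<close> of \<open>X\<close> into \<open>V\<close> that preserves the pairings with \<open>F\<close>; the last conjunct,
  which says that \<open>P\<close> has an adjoint on \<open>X'\<close>, is what makes the induction work.
\<close>

lemma exists_interpolating_projection:
  assumes X: "family_subspace X" and V: "family_subspace V" "V \<subseteq> X"
    and sep: "\<And>y. y \<in> seq_dual X \<Longrightarrow> \<forall>v\<in>V. pairing v y = 0 \<Longrightarrow> \<forall>x\<in>X. pairing x y = 0"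
    and "finite F" "F \<subseteq> seq_dual X"
  shows "\<exists>P. (\<forall>x\<in>X. P x \<in> V) \<and> (\<forall>x\<in>X. \<forall>y\<in>F. pairing (P x) y = pairing x y) \<and>
    (\<forall>z\<in>seq_dual X. \<exists>w\<in>seq_dual X. \<forall>x\<in>X. pairing (P x) z = pairing x w)"
  using assms(5,6)
proof (induction F rule: finite_induct)
  case empty
  have "\<exists>w\<in>seq_dual X. \<forall>x\<in>X. pairing (\<lambda>_. 0) z = pairing x w" for z
    by (rule bexI[OF _ family_subspaceD(1)[OF family_subspace_seq_dual]]) (simp add: pairing_def)
  then show ?case
    using family_subspaceD(1)[OF V(1)] by (intro exI[of _ "\<lambda>_ _. 0"]) auto
next
  case (insert z F)
  then obtain P where P: "\<forall>x\<in>X. P x \<in> V" "\<forall>x\<in>X. \<forall>y\<in>F. pairing (P x) y = pairing x y"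
    and adj: "\<forall>z\<in>seq_dual X. \<exists>w\<in>seq_dual X. \<forall>x\<in>X. pairing (P x) z = pairing x w"
    by auto
  have z: "z \<in> seq_dual X" and F: "F \<subseteq> seq_dual X" using insert.prems by auto
  have PX: "P x \<in> X" if "x \<in> X" for x using P(1) V(2) that by blast
  obtain z' where z': "z' \<in> seq_dual X" "\<forall>x\<in>X. pairing (P x) z = pairing x z'"
    using adj z by blast
  \<comment> \<open>\<open>w\<close> represents the error made by \<open>P\<close> at
    \<open>z\<close>, and it lies in X' thanks to the adjoint. If it vanishes on \<open>V\<close>,
    then by \<open>sep\<close> it vanishes on \<open>X\<close> and \<open>P\<close> needs no
    change.\<close>
  define w where "w = (\<lambda>\<alpha>. z \<alpha> - z' \<alpha>)"
  have w: "w \<in> seq_dual X"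
    unfolding w_def by (rule family_subspace_diff[OF family_subspace_seq_dual z z'(1)])
  have pw: "pairing x w = pairing x z - pairing (P x) z" if "x \<in> X" for x
    using pairing_diff_right[OF z z'(1) that] z'(2) that by (simp add: w_def)
  show ?case
  proof (cases "\<forall>v\<in>V. pairing v w = 0")
    case True
    then have "\<forall>x\<in>X. pairing x w = 0" by (rule sep[OF w])
    then have "\<forall>x\<in>X. pairing (P x) z = pairing x z" using pw by simp
    with P adj show ?thesis by (intro exI[of _ P]) auto
  next
    case False
    then obtain v where v: "v \<in> V" "pairing v w \<noteq> 0" by blast
    define c where "c = pairing v w"
    \<comment> \<open>\<open>u\<close> pairs to 0 with every element of \<open>F\<close> and to
      \<open>c\<close> with \<open>z\<close>, so a multiple of it corrects the error at
      \<open>z\<close> without disturbing \<open>F\<close>.\<close>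
    define u where "u = (\<lambda>\<alpha>. v \<alpha> - P v \<alpha>)"
    have vX: "v \<in> X" using v V(2) by blast
    have uV: "u \<in> V"
      unfolding u_def using P(1) v vX by (intro family_subspace_diff[OF V(1)]) auto
    then have uX: "u \<in> X" using V(2) by blast
    have pu: "pairing u y = pairing v y - pairing (P v) y" if "y \<in> seq_dual X" for y
      unfolding u_def by (rule pairing_diff_left[OF X that vX PX[OF vX]])
    define Q where "Q x = (\<lambda>\<alpha>. P x \<alpha> + (pairing x w / c) * u \<alpha>)" for x
    have pQ: "pairing (Q x) y = pairing (P x) y + (pairing x w / c) * pairing u y"
      if "x \<in> X" "y \<in> seq_dual X" for x y
      unfolding Q_def
      using pairing_add_left[OF that(2) PX[OF that(1)] family_subspaceD(3)[OF X uX], of "pairing x w / c"]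
      by (simp only: pairing_cmult_left)
    show ?thesis
    proof (intro exI[of _ Q] conjI ballI)
      fix x assume x: "x \<in> X"
      show "Q x \<in> V"
        unfolding Q_def using P(1) x uV by (intro family_subspaceD[OF V(1)]) auto
      fix y assume "y \<in> insert z F"
      then show "pairing (Q x) y = pairing x y"
      proof
        assume "y = z"
        moreover have "pairing u z = c"
          using pu[OF z] pw[OF vX] by (simp add: c_def)
        ultimately show ?thesis
          using pQ[OF x z] pw[OF x] v(2) by (simp add: c_def)
      next
        assume "y \<in> F"
        moreover have "pairing u y = 0"
          using pu[of y] P(2) vX \<open>y \<in> F\<close> F by auto
        ultimately show ?thesis
          using pQ[OF x, of y] P(2) x F by auto
      qed
    next
      fix y assume y: "y \<in> seq_dual X"
      then obtain y' where y': "y' \<in> seq_dual X" "\<forall>x\<in>X. pairing (P x) y = pairing x y'"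
        using adj by blast
      \<comment> \<open>The adjoint of the new projection at y: the adjoint of \<open>P\<close> plus
        the transpose of the rank-one correction.\<close>
      define w' where "w' = (\<lambda>\<alpha>. y' \<alpha> + (pairing u y / c) * w \<alpha>)"
      have "w' \<in> seq_dual X"
        unfolding w'_def
        by (intro family_subspaceD(2,3)[OF family_subspace_seq_dual] y' w)
      moreover have "pairing (Q x) y = pairing x w'" if x: "x \<in> X" for x
        unfolding w'_def pQ[OF x y]
        using pairing_add_right[OF y'(1) family_subspaceD(3)[OF family_subspace_seq_dual w] x, of "pairing u y / c"] y'(2) x
        by (simp only: pairing_cmult_right) simp
      ultimately show "\<exists>w'\<in>seq_dual X. \<forall>x\<in>X. pairing (Q x) y = pairing x w'" by blast
    qed
  qed
qed

text \<open>Exact agreement with x on finitely many functionals keeps a point inside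
  \<open>U\<close>; density therefore becomes a problem of exact interpolation.\<close>

lemma openin_weak_topologyD:
  assumes "openin (weak_topology X) U" "x \<in> U"
  shows "\<exists>F. finite F \<and> F \<subseteq> seq_dual X \<and> {x'\<in>X. \<forall>y\<in>F. pairing x' y = pairing x y} \<subseteq> U"
proof -
  have "generate_topology_on {{x \<in> X. pairing x y \<in> U} | y U. y \<in> seq_dual X \<and> open U} U"
    using assms(1) unfolding weak_topology_def by (rule openin_topology_generated_by)
  then show ?thesis
    using assms(2)
  proof (induction rule: generate_topology_on.induct)
    case (Int a b)
    then obtain F G where "finite F" "F \<subseteq> seq_dual X" "{x'\<in>X. \<forall>y\<in>F. pairing x' y = pairing x y} \<subseteq> a"
      "finite G" "G \<subseteq> seq_dual X" "{x'\<in>X. \<forall>y\<in>G. pairing x' y = pairing x y} \<subseteq> b"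
      by blast
    then show ?case by (intro exI[of _ "F \<union> G"]) auto
  next
    case (UN K)
    then obtain k where k: "k \<in> K" "x \<in> k" by blast
    with UN.IH[OF k] show ?case by (meson Union_upper order_trans)
  next
    case (Basis s)
    then obtain y U where "s = {x \<in> X. pairing x y \<in> U}" "y \<in> seq_dual X" by blast
    with Basis.prems show ?case by (intro exI[of _ "{y}"]) auto
  qed simp
qed

text \<open>The annihilator criterion for density. The interpolating projection moves x into
  \<open>V\<close> without changing the finitely many pairings that decide membership in a given
  neighbourhood.\<close>

lemma dense_in_weak_topology:
  assumes X: "family_subspace X" and V: "family_subspace V" "V \<subseteq> X"
    and sep: "\<And>y. y \<in> seq_dual X \<Longrightarrow> \<forall>v\<in>V. pairing v y = 0 \<Longrightarrow> \<forall>x\<in>X. pairing x y = 0"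
  shows "dense_in_topology (weak_topology X) V"
proof -
  have "\<exists>v\<in>V. v \<in> U" if U: "x \<in> U" "openin (weak_topology X) U" for x U
  proof -
    have x: "x \<in> X"
      using U openin_subset[of "weak_topology X" U] by (auto simp: topspace_weak_topology)
    obtain F where F: "finite F" "F \<subseteq> seq_dual X" "{x'\<in>X. \<forall>y\<in>F. pairing x' y = pairing x y} \<subseteq> U"
      using openin_weak_topologyD[OF U(2,1)] by blast
    obtain P where "\<forall>x\<in>X. P x \<in> V" "\<forall>x\<in>X. \<forall>y\<in>F. pairing (P x) y = pairing x y"
      using exists_interpolating_projection[OF X V sep F(1,2)] by blast
    with x F(3) V(2) have "P x \<in> V" "P x \<in> U" by blast+
    then show ?thesis by blast
  qed
  then have "X \<subseteq> weak_topology X closure_of V"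
    unfolding subset_iff in_closure_of topspace_weak_topology by blast
  then show ?thesis
    using V(2) closure_of_subset_topspace[of "weak_topology X" V]
    by (auto simp: dense_in_topology_def topspace_weak_topology)
qed

section \<open>The dual of an ideal sequence space\<close>

context ISL
begin

lemma unit_family_mem: "unit_family \<alpha> \<in> X"
  using shift_mem[OF unit_mem, of \<alpha>] by (simp add: shift_unit_family)

lemma nrm_unit_pos: "0 < nrm (unit_family \<alpha>)"
proof -
  have "unit_family \<alpha> \<noteq> (\<lambda>_. 0)"
    by (metis unit_family_def zero_neq_one)
  then show ?thesis
    using nrm_eq_0_iff[OF unit_family_mem] nrm_nonneg[OF unit_family_mem, of \<alpha>] by fastforce
qed

text \<open>By solidity x dominates its own single coordinate; in particular coordinate functionals
  are continuous.\<close>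

lemma cmod_mult_nrm_unit_le:
  assumes "x \<in> X"
  shows "cmod (x \<alpha>) * nrm (unit_family \<alpha>) \<le> nrm x"
proof -
  have "nrm (\<lambda>\<beta>. x \<alpha> * unit_family \<alpha> \<beta>) \<le> nrm x"
    using solid[OF assms, of "\<lambda>\<beta>. x \<alpha> * unit_family \<alpha> \<beta>"] by (simp add: unit_family_def)
  then show ?thesis
    by (simp add: nrm_scale unit_family_mem)
qed

text \<open>Continuity of the inclusion of \<ell>^1, tested on unit families. If their norms were
  unbounded, a summable family supported on a rapidly growing sequence of them would have infinite
  norm.\<close>

lemma nrm_unit_bounded:
  assumes "lp_space 1 \<subseteq> X"
  shows "\<exists>C. \<forall>\<alpha>. nrm (unit_family \<alpha>) \<le> C"
proof (rule ccontr)
  assume "\<not> ?thesis"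
  then have "\<exists>\<alpha>. 4 ^ k < nrm (unit_family \<alpha>)" for k :: nat
    by (meson not_le)
  then obtain a where a: "4 ^ k < nrm (unit_family (a k))" for k :: nat
    by metis
  \<comment> \<open>The inverse square root divides the growth 4^k evenly: the entries are at most
    2^(-k), while entry times unit norm exceeds 2^k. As \<open>a\<close> need not be injective,
    \<open>g\<close> is defined on its range.\<close>
  define g where "g \<alpha> = (if \<alpha> \<in> range a then 1 / sqrt (nrm (unit_family \<alpha>)) else 0)" for \<alpha>
  have g_nonneg: "0 \<le> g \<alpha>" for \<alpha>
    using nrm_unit_pos[of \<alpha>] by (simp add: g_def)
  have ga: "g (a k) \<le> (1 / 2) ^ k" for k
  proof -
    have "2 ^ k = sqrt (4 ^ k)" by (simp add: real_sqrt_power)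
    also have "\<dots> \<le> sqrt (nrm (unit_family (a k)))" using a[of k] by simp
    finally show ?thesis
      by (simp add: g_def power_one_over frac_le)
  qed
  have "g summable_on range a"
  proof (rule nonneg_bdd_above_summable_on)
    show "bdd_above (sum g ` {F. F \<subseteq> range a \<and> finite F})"
    proof (rule bdd_aboveI2)
      fix F assume "F \<in> {F. F \<subseteq> range a \<and> finite F}"
      then obtain K where K: "finite K" "F = a ` K"
        by (auto dest: finite_subset_image)
      have "sum g F \<le> sum (g \<circ> a) K"
        unfolding K(2) using K(1) g_nonneg by (rule sum_image_le)
      also have "\<dots> \<le> (\<Sum>k\<in>K. (1 / 2) ^ k)"
        by (intro sum_mono) (simp add: ga)
      also have "\<dots> \<le> suminf ((^) (1 / 2))"
        by (intro sum_le_suminf K(1)) auto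
      finally show "sum g F \<le> 2" by (simp add: suminf_geometric)
    qed
  qed (rule g_nonneg)
  then have "g summable_on UNIV"
    by (rule summable_on_cong_neutral[THEN iffD1, rotated -1]) (auto simp: g_def)
  then have "(\<lambda>\<alpha>. complex_of_real (g \<alpha>)) \<in> lp_space 1"
    using g_nonneg by (simp add: lp_space_def)
  then have mem: "(\<lambda>\<alpha>. complex_of_real (g \<alpha>)) \<in> X" using assms by blast
  have "2 ^ k \<le> nrm (\<lambda>\<alpha>. complex_of_real (g \<alpha>))" for k
  proof -
    have "2 ^ k = sqrt (4 ^ k)" by (simp add: real_sqrt_power)
    also have "\<dots> \<le> sqrt (nrm (unit_family (a k)))" using a[of k] by simp
    also have "\<dots> = g (a k) * nrm (unit_family (a k))"
      using nrm_unit_pos[of "a k"] by (simp add: g_def real_div_sqrt)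
    also have "\<dots> \<le> nrm (\<lambda>\<alpha>. complex_of_real (g \<alpha>))"
      using cmod_mult_nrm_unit_le[OF mem, of "a k"] g_nonneg by simp
    finally show ?thesis .
  qed
  then show False
    by (meson leD one_less_numeral_iff real_arch_pow semiring_norm(76))
qed

text \<open>The element is the sum of 2^(-k) times the moduli of \<open>x k\<close>, which converges
  by completeness. Norm limits are coordinatewise limits, and a partial sum of nonnegative terms is
  at least each of its terms.\<close>

lemma exists_dominating_element:
  assumes x: "\<And>k. x k \<in> X" "\<And>k. nrm (x k) \<le> 1"
  shows "\<exists>z\<in>X. \<forall>k \<alpha>. cmod (x k \<alpha>) \<le> 2 ^ k * cmod (z \<alpha>)"
proof -
  define s where "s n = (\<lambda>\<alpha>. complex_of_real (\<Sum>k<n. (1 / 2) ^ k * cmod (x k \<alpha>)))" for n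
  interpret M: Metric_space X "norm_dist X nrm" by (rule Metric_space_norm_dist)
  have abs: "(\<lambda>\<alpha>. complex_of_real (cmod (x k \<alpha>))) \<in> X" "nrm (\<lambda>\<alpha>. complex_of_real (cmod (x k \<alpha>))) \<le> 1" for k
    using solid[OF x(1)[of k], of "\<lambda>\<alpha>. complex_of_real (cmod (x k \<alpha>))"] x(2)[of k] by auto
  have s_Suc: "s (Suc n) = (\<lambda>\<alpha>. s n \<alpha> + complex_of_real ((1 / 2) ^ n) * complex_of_real (cmod (x n \<alpha>)))" for n
    by (simp add: s_def)
  have s_mem: "s n \<in> X" for n
  proof (induction n)
    case 0 then show ?case using zero_mem by (simp add: s_def)
  next
    case (Suc n) then show ?case unfolding s_Suc by (intro add_mem scale_mem abs)
  qed
  have step: "norm_dist X nrm (s n) (s (Suc n)) \<le> (1 / 2) ^ n" for n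
  proof -
    have "norm_dist X nrm (s (Suc n)) (s n) = nrm (\<lambda>\<alpha>. complex_of_real ((1 / 2) ^ n) * complex_of_real (cmod (x n \<alpha>)))"
      using s_mem by (simp add: norm_dist_def) (simp add: s_Suc)
    also have "\<dots> = (1 / 2) ^ n * nrm (\<lambda>\<alpha>. complex_of_real (cmod (x n \<alpha>)))"
      by (subst nrm_scale[OF abs(1)]) (simp add: norm_power)
    also have "\<dots> \<le> (1 / 2) ^ n * 1"
      by (intro mult_left_mono abs) simp
    finally show ?thesis using M.commute by simp
  qed
  \<comment> \<open>The geometric tail is kept in telescoping form so that the induction on
    \<open>j\<close> closes.\<close>
  have dist: "norm_dist X nrm (s n) (s (n + j)) \<le> 2 * (1 / 2) ^ n - 2 * (1 / 2) ^ (n + j)" for n j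
  proof (induction j)
    case (Suc j)
    have "norm_dist X nrm (s n) (s (n + Suc j))
        \<le> norm_dist X nrm (s n) (s (n + j)) + norm_dist X nrm (s (n + j)) (s (Suc (n + j)))"
      using M.triangle[OF s_mem s_mem s_mem] by simp
    then show ?case using Suc step[of "n + j"] by simp
  qed (simp add: s_mem)
  have dist': "norm_dist X nrm (s n) (s m) \<le> 2 * (1 / 2) ^ N" if "N \<le> n" "n \<le> m" for n m N
  proof -
    have "norm_dist X nrm (s n) (s m) \<le> 2 * (1 / 2) ^ n"
      using dist[of n "m - n"] that by (smt (verit) le_add_diff_inverse zero_le_power divide_nonneg_nonneg)
    also have "\<dots> \<le> 2 * (1 / 2) ^ N"
      using that by (simp add: power_decreasing)
    finally show ?thesis .
  qed
  have "M.MCauchy s"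
    unfolding M.MCauchy_def
  proof (intro conjI allI impI)
    show "range s \<subseteq> X" using s_mem by blast
    fix e :: real assume "0 < e"
    then obtain N where N: "(1 / 2 :: real) ^ N < e / 2"
      using real_arch_pow_inv[of "e / 2" "1 / 2"] by auto
    have "norm_dist X nrm (s n) (s m) < e" if "N \<le> n" "N \<le> m" for n m
      using dist'[OF that(1), of m] dist'[OF that(2), of n] N M.commute[of "s n" "s m"]
      by (cases n m rule: le_cases) auto
    then show "\<exists>N. \<forall>n m. N \<le> n \<longrightarrow> N \<le> m \<longrightarrow> norm_dist X nrm (s n) (s m) < e" by blast
  qed
  then obtain z where "limitin M.mtopology s z sequentially"
    using complete unfolding M.mcomplete_def by blast
  then have z: "z \<in> X" and lim: "(\<lambda>n. norm_dist X nrm (s n) z) \<longlonglongrightarrow> 0"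
    unfolding M.limitin_metric_dist_null by blast+
  have "cmod (x k \<alpha>) \<le> 2 ^ k * cmod (z \<alpha>)" for k \<alpha>
  proof -
    have "(\<lambda>n. norm_dist X nrm (s n) z / nrm (unit_family \<alpha>)) \<longlonglongrightarrow> 0"
      using tendsto_divide_zero[OF lim] by blast
    moreover have "\<forall>\<^sub>F n in sequentially. cmod (s n \<alpha> - z \<alpha>) \<le> norm_dist X nrm (s n) z / nrm (unit_family \<alpha>)"
      using cmod_mult_nrm_unit_le[OF minus_mem[OF s_mem z], of _ \<alpha>] nrm_unit_pos[of \<alpha>] s_mem z
      by (simp add: norm_dist_def field_simps)
    ultimately have "(\<lambda>n. s n \<alpha> - z \<alpha>) \<longlonglongrightarrow> 0"
      by (rule Lim_null_comparison[rotated])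
    then have "(\<lambda>n. cmod (s n \<alpha>)) \<longlonglongrightarrow> cmod (z \<alpha>)"
      by (intro tendsto_norm) (simp add: LIM_zero_iff)
    moreover have "(1 / 2) ^ k * cmod (x k \<alpha>) \<le> cmod (s n \<alpha>)" if "Suc k \<le> n" for n
    proof -
      have "(1 / 2) ^ k * cmod (x k \<alpha>) \<le> (\<Sum>k<n. (1 / 2) ^ k * cmod (x k \<alpha>))"
        using that by (intro member_le_sum) auto
      then show ?thesis by (simp add: s_def del: of_real_sum)
    qed
    ultimately have "(1 / 2) ^ k * cmod (x k \<alpha>) \<le> cmod (z \<alpha>)"
      by (intro LIMSEQ_le_const) auto
    then show ?thesis by (simp add: field_simps)
  qed
  with z show ?thesis by blast
qed

text \<open>If the pairing exceeded 4^k at elements \<open>x k\<close> of the unit ball, an element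
  z dominating them up to the factors 2^k would have an absolute pairing with y larger than every
  2^k, although the latter is finite.\<close>

lemma pairing_bounded:
  assumes y: "y \<in> seq_dual X"
  shows "\<exists>C. \<forall>x\<in>X. cmod (pairing x y) \<le> C * nrm x"
proof -
  have "\<exists>C. \<forall>x\<in>X. nrm x \<le> 1 \<longrightarrow> cmod (pairing x y) \<le> C"
  proof (rule ccontr)
    assume "\<not> ?thesis"
    then have "\<exists>x\<in>X. nrm x \<le> 1 \<and> 4 ^ k < cmod (pairing x y)" for k :: nat
      by (meson not_le)
    then obtain x where x: "\<And>k :: nat. x k \<in> X" "\<And>k. nrm (x k) \<le> 1" "\<And>k. 4 ^ k < cmod (pairing (x k) y)"
      by metis
    obtain z where z: "z \<in> X" "\<And>k \<alpha>. cmod (x k \<alpha>) \<le> 2 ^ k * cmod (z \<alpha>)"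
      using exists_dominating_element[of x] x(1,2) by blast
    define S where "S = (\<Sum>\<^sub>\<infinity>\<alpha>. cmod (z \<alpha> * y \<alpha>))"
    have "2 ^ k < S" for k
    proof -
      have "(4 :: real) ^ k < cmod (pairing (x k) y)" by (rule x(3))
      also have "\<dots> \<le> (\<Sum>\<^sub>\<infinity>\<alpha>. cmod (x k \<alpha> * y \<alpha>))"
        unfolding pairing_def by (rule norm_infsum_bound[OF seq_dualD[OF y x(1)]])
      also have "\<dots> \<le> (\<Sum>\<^sub>\<infinity>\<alpha>. 2 ^ k * cmod (z \<alpha> * y \<alpha>))"
        using mult_right_mono[OF z(2)]
        by (intro infsum_mono summable_on_cmult_right seq_dualD[OF y] x(1) z(1)) (simp add: norm_mult mult.assoc)
      also have "\<dots> = 2 ^ k * S"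
        by (simp add: S_def infsum_cmult_right')
      finally have "2 ^ k * 2 ^ k < 2 ^ k * S"
        by (simp flip: power_mult_distrib)
      then show ?thesis by simp
    qed
    then show False
      by (meson less_asym one_less_numeral_iff real_arch_pow semiring_norm(76))
  qed
  then obtain C where C: "\<And>x. x \<in> X \<Longrightarrow> nrm x \<le> 1 \<Longrightarrow> cmod (pairing x y) \<le> C" by blast
  have "cmod (pairing x y) \<le> C * nrm x" if x: "x \<in> X" for x
  proof (cases "nrm x = 0")
    case True
    then show ?thesis using x by (simp add: nrm_eq_0_iff pairing_def nrm_zero)
  next
    case False
    then have pos: "0 < nrm x" using nrm_nonneg[OF x] by simp
    have "cmod (pairing (\<lambda>\<alpha>. complex_of_real (1 / nrm x) * x \<alpha>) y) \<le> C"
      using nrm_scale[OF x, of "complex_of_real (1 / nrm x)"] pos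
      by (intro C scale_mem x) (simp add: norm_divide)
    then show ?thesis
      using pos by (simp only: pairing_cmult_left norm_mult) (simp add: norm_divide field_simps)
  qed
  then show ?thesis by blast
qed

text \<open>Embeds X' isometrically into the Banach dual, so that the norm axioms of X' are
  inherited from there.\<close>

definition dual_functional :: "('i \<Rightarrow> complex) \<Rightarrow> ('i \<Rightarrow> complex) \<Rightarrow> complex"
  where "dual_functional y x = (if x \<in> X then pairing x y else 0)"

lemma dual_functional_mem:
  assumes "y \<in> seq_dual X"
  shows "dual_functional y \<in> banach_dual X nrm"
proof -
  obtain C where C: "\<And>x. x \<in> X \<Longrightarrow> cmod (pairing x y) \<le> C * nrm x"
    using pairing_bounded[OF assms] by blast
  show ?thesis
    by (rule banach_dualI[where C = C])
      (simp_all add: dual_functional_def C add_mem scale_mem pairing_add_left[OF assms] pairing_cmult_left)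
qed

lemma seq_dual_norm_eq: "seq_dual_norm X nrm y = banach_dual_norm X nrm (dual_functional y)"
  unfolding seq_dual_norm_def banach_dual_norm_def
  by (rule arg_cong[where f = Sup]) (auto simp: dual_functional_def)

lemma normed_family_space_seq_dual: "normed_family_space (seq_dual X) (seq_dual_norm X nrm)"
proof
  interpret D: normed_family_space "banach_dual X nrm" "banach_dual_norm X nrm"
    by (rule normed_family_space_banach_dual)
  show "(\<lambda>_. 0) \<in> seq_dual X"
    by (rule family_subspaceD(1)[OF family_subspace_seq_dual])
  fix y assume y: "y \<in> seq_dual X"
  show "(\<lambda>\<alpha>. c * y \<alpha>) \<in> seq_dual X" for c
    by (rule family_subspaceD(3)[OF family_subspace_seq_dual y])
  show "0 \<le> seq_dual_norm X nrm y"
    unfolding seq_dual_norm_eq by (rule D.nrm_nonneg[OF dual_functional_mem[OF y]])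
  have "dual_functional y = (\<lambda>x. 0) \<longleftrightarrow> y = (\<lambda>\<alpha>. 0)"
  proof
    have "dual_functional y (unit_family \<alpha>) = y \<alpha>" for \<alpha>
      by (simp add: dual_functional_def unit_family_mem pairing_unit_family)
    moreover assume "dual_functional y = (\<lambda>x. 0)"
    ultimately have "y \<alpha> = 0" for \<alpha> by simp
    then show "y = (\<lambda>\<alpha>. 0)" by blast
  qed (auto simp: dual_functional_def pairing_def fun_eq_iff)
  then show "seq_dual_norm X nrm y = 0 \<longleftrightarrow> y = (\<lambda>\<alpha>. 0)"
    unfolding seq_dual_norm_eq using D.nrm_eq_0_iff[OF dual_functional_mem[OF y]] by simp
  have "dual_functional (\<lambda>\<alpha>. c * y \<alpha>) = (\<lambda>x. c * dual_functional y x)" for c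
    by (simp add: dual_functional_def[abs_def] pairing_cmult_right fun_eq_iff)
  then show "seq_dual_norm X nrm (\<lambda>\<alpha>. c * y \<alpha>) = cmod c * seq_dual_norm X nrm y" for c
    unfolding seq_dual_norm_eq using D.nrm_scale[OF dual_functional_mem[OF y]] by simp
  fix z assume z: "z \<in> seq_dual X"
  show "(\<lambda>\<alpha>. y \<alpha> + z \<alpha>) \<in> seq_dual X"
    by (rule family_subspaceD(2)[OF family_subspace_seq_dual y z])
  have "dual_functional (\<lambda>\<alpha>. y \<alpha> + z \<alpha>) = (\<lambda>x. dual_functional y x + dual_functional z x)"
    using pairing_add_right[OF y z] by (auto simp: dual_functional_def fun_eq_iff)
  then show "seq_dual_norm X nrm (\<lambda>\<alpha>. y \<alpha> + z \<alpha>) \<le> seq_dual_norm X nrm y + seq_dual_norm X nrm z"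
    unfolding seq_dual_norm_eq
    using D.nrm_triangle[OF dual_functional_mem[OF y] dual_functional_mem[OF z]] by simp
qed

lemma cmod_le_seq_dual_norm:
  assumes "y \<in> seq_dual X"
  shows "cmod (y \<alpha>) \<le> seq_dual_norm X nrm y * nrm (unit_family \<alpha>)"
  using cmod_le_banach_dual_norm_mult[OF dual_functional_mem[OF assms] unit_family_mem[of \<alpha>]]
  by (simp add: seq_dual_norm_eq dual_functional_def unit_family_mem pairing_unit_family)

text \<open>With bounded unit norms, coordinates are bounded uniformly by the dual norm. An
  approximating finite family z is then uniformly close to y, so y can be large only on the support
  of z.\<close>

lemma vanishing_seq_dual:
  assumes l1: "lp_space 1 \<subseteq> X" and dense: "finite_families_dense_in_dual X nrm"
    and y: "y \<in> seq_dual X"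
  shows "vanishing y"
  unfolding vanishing_def
proof (intro allI impI)
  fix e :: real assume "0 < e"
  interpret D: normed_family_space "seq_dual X" "seq_dual_norm X nrm"
    by (rule normed_family_space_seq_dual)
  interpret M: Metric_space "seq_dual X" "norm_dist (seq_dual X) (seq_dual_norm X nrm)"
    by (rule D.Metric_space_norm_dist)
  obtain C where C: "\<And>\<alpha>. nrm (unit_family \<alpha>) \<le> C"
    using nrm_unit_bounded[OF l1] by blast
  then have "0 < C" using nrm_unit_pos less_le_trans by blast
  have "y \<in> M.mtopology closure_of {z. finite {\<alpha>. z \<alpha> \<noteq> 0}}"
    using dense y by (simp add: finite_families_dense_in_dual_def dense_in_topology_def norm_topology_def)
  then obtain z where z: "finite {\<alpha>. z \<alpha> \<noteq> 0}" "z \<in> M.mball y (e / C)"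
    unfolding M.metric_closure_of using \<open>0 < e\<close> \<open>0 < C\<close> by (auto dest!: spec[of _ "e / C"])
  then have zX: "z \<in> seq_dual X" and less: "seq_dual_norm X nrm (\<lambda>\<alpha>. y \<alpha> - z \<alpha>) < e / C"
    by (auto simp: norm_dist_def)
  have "cmod (y \<alpha> - z \<alpha>) < e" for \<alpha>
  proof -
    have "cmod (y \<alpha> - z \<alpha>) \<le> seq_dual_norm X nrm (\<lambda>\<alpha>. y \<alpha> - z \<alpha>) * nrm (unit_family \<alpha>)"
      by (rule cmod_le_seq_dual_norm[OF D.minus_mem[OF y zX]])
    also have "\<dots> \<le> seq_dual_norm X nrm (\<lambda>\<alpha>. y \<alpha> - z \<alpha>) * C"
      by (intro mult_left_mono C D.nrm_nonneg D.minus_mem y zX)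
    also have "\<dots> < e" using less \<open>0 < C\<close> by (simp add: field_simps)
    finally show ?thesis .
  qed
  then have "{\<alpha>. e \<le> cmod (y \<alpha>)} \<subseteq> {\<alpha>. z \<alpha> \<noteq> 0}"
    by (auto simp: not_le[symmetric]) (metis diff_zero not_le)
  then show "finite {\<alpha>. e \<le> cmod (y \<alpha>)}"
    using z(1) by (rule finite_subset)
qed

lemma cyclic_weak_topology:
  assumes l1: "lp_space 1 \<subseteq> X" and dense: "finite_families_dense_in_dual X nrm"
    and f: "finite {\<alpha>. f \<alpha> \<noteq> 0}" "backward_injective f"
  shows "cyclic_element (weak_topology X) f"
  unfolding cyclic_element_def
proof
  show "f \<in> topspace (weak_topology X)"
    by (simp add: topspace_weak_topology finite_support_mem[OF family_subspace_carrier unit_family_mem f(1)])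
  show "dense_in_topology (weak_topology X) {poly_times p f | p. True}"
  proof (rule dense_in_weak_topology[OF family_subspace_carrier family_subspace_poly_times])
    show "{poly_times p f | p. True} \<subseteq> X"
      using poly_times_mem[OF family_subspace_carrier unit_family_mem f(1)] by blast
    fix y assume y: "y \<in> seq_dual X" and zero: "\<forall>v\<in>{poly_times p f | p. True}. pairing v y = 0"
    have "backward f y \<beta> = 0" for \<beta>
      using zero pairing_shift[OF f(1), of \<beta> y] by (metis (mono_tags, lifting) mem_Collect_eq poly_times_single)
    then have "\<forall>\<alpha>. y \<alpha> = 0"
      using f(2) vanishing_seq_dual[OF l1 dense y] unfolding backward_injective_def by blast
    then show "\<forall>x\<in>X. pairing x y = 0" by (simp add: pairing_def)
  qed
qed

end

section \<open>Norm cyclicity\<close>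

context normed_family_space
begin

lemma banach_dual_sum:
  assumes \<phi>: "\<phi> \<in> banach_dual X nrm" and g: "\<And>i. i \<in> I \<Longrightarrow> g i \<in> X"
  shows "\<phi> (\<lambda>\<beta>. \<Sum>i\<in>I. c i * g i \<beta>) = (\<Sum>i\<in>I. c i * \<phi> (g i))"
proof -
  have zero: "\<phi> (\<lambda>_. 0) = 0"
    using banach_dualD(2)[OF \<phi> zero_mem, of 0] by simp
  show ?thesis
    using g
  proof (induction I rule: infinite_finite_induct)
    case (insert i I)
    have "(\<lambda>\<beta>. \<Sum>i\<in>I. c i * g i \<beta>) \<in> X"
      by (rule family_subspace_sum[OF family_subspace_carrier]) (use insert.prems in \<open>auto intro: scale_mem\<close>)
    then have "\<phi> (\<lambda>\<beta>. c i * g i \<beta> + (\<Sum>i\<in>I. c i * g i \<beta>)) = c i * \<phi> (g i) + \<phi> (\<lambda>\<beta>. \<Sum>i\<in>I. c i * g i \<beta>)"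
      using insert.prems banach_dualD(1,2)[OF \<phi>] scale_mem by simp
    with insert show ?case by simp
  qed (simp_all add: zero)
qed

lemma banach_dual_finite_support:
  assumes \<phi>: "\<phi> \<in> banach_dual X nrm" and unit: "\<And>\<alpha>. unit_family \<alpha> \<in> X" and f: "finite {\<alpha>. f \<alpha> \<noteq> 0}"
  shows "\<phi> f = (\<Sum>\<alpha> | f \<alpha> \<noteq> 0. f \<alpha> * \<phi> (unit_family \<alpha>))"
  using banach_dual_sum[OF \<phi> unit, of f "\<lambda>\<alpha>. \<alpha>" "{\<alpha>. f \<alpha> \<noteq> 0}"]
  by (subst family_eq_sum_unit_family[OF f]) simp

end

text \<open>
  By the separation theorem it suffices that functionals are determined by their values on the
  unit families and that these values vanish at infinity.
\<close>

lemma cyclic_norm_topology: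
  fixes f :: "'i :: cancel_comm_monoid_add \<Rightarrow> complex"
  assumes "normed_family_space X nrm" and unit: "\<And>\<alpha>. unit_family \<alpha> \<in> X"
    and van: "\<And>\<phi>. \<phi> \<in> banach_dual X nrm \<Longrightarrow> vanishing (\<lambda>\<alpha>. \<phi> (unit_family \<alpha>))"
    and det: "\<And>\<phi> x. \<phi> \<in> banach_dual X nrm \<Longrightarrow> \<forall>\<alpha>. \<phi> (unit_family \<alpha>) = 0 \<Longrightarrow> x \<in> X \<Longrightarrow> \<phi> x = 0"
    and f: "finite {\<alpha>. f \<alpha> \<noteq> 0}" "backward_injective f"
  shows "cyclic_element (norm_topology X nrm) f"
proof -
  interpret normed_family_space X nrm by fact
  interpret M: Metric_space X "norm_dist X nrm" by (rule Metric_space_norm_dist)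
  let ?V = "{poly_times p f | p. True}"
  have V: "family_subspace ?V" by (rule family_subspace_poly_times)
  have VX: "?V \<subseteq> X"
    using poly_times_mem[OF family_subspace_carrier unit f(1)] by blast
  have "x \<in> M.mtopology closure_of ?V" if x: "x \<in> X" for x
  proof (rule ccontr)
    assume "x \<notin> M.mtopology closure_of ?V"
    then obtain r where r: "0 < r" "\<forall>v\<in>?V. v \<notin> M.mball x r"
      unfolding M.metric_closure_of using x by blast
    \<comment> \<open>The separation theorem measures distance by sums, the metric by differences;
      closure under negation reconciles them.\<close>
    have dist: "r \<le> nrm (\<lambda>\<alpha>. v \<alpha> + x \<alpha>)" if v: "v \<in> ?V" for v
    proof -
      have "(\<lambda>\<alpha>. - v \<alpha>) \<in> ?V" by (rule family_subspace_uminus[OF V v])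
      then have "(\<lambda>\<alpha>. - v \<alpha>) \<in> X" "(\<lambda>\<alpha>. - v \<alpha>) \<notin> M.mball x r"
        using r(2) VX by blast+
      then have "r \<le> norm_dist X nrm x (\<lambda>\<alpha>. - v \<alpha>)"
        using x by simp
      then show ?thesis
        using x \<open>(\<lambda>\<alpha>. - v \<alpha>) \<in> X\<close> by (simp add: norm_dist_def add.commute)
    qed
    obtain \<phi> where \<phi>: "\<phi> \<in> banach_dual X nrm" "\<And>v. v \<in> ?V \<Longrightarrow> \<phi> v = 0" "\<phi> x \<noteq> 0"
      using exists_separating_functional[OF V VX x r(1) dist] by blast
    have "backward f (\<lambda>\<alpha>. \<phi> (unit_family \<alpha>)) \<beta> = 0" for \<beta>
    proof -
      have "finite {\<alpha>. shift \<beta> f \<alpha> \<noteq> 0}"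
        by (simp add: shift_support f(1))
      then have "\<phi> (shift \<beta> f) = backward (shift \<beta> f) (\<lambda>\<alpha>. \<phi> (unit_family \<alpha>)) 0"
        by (simp add: banach_dual_finite_support[OF \<phi>(1) unit] backward_def)
      moreover have "shift \<beta> f \<in> ?V"
        using poly_times_single[of \<beta> f, symmetric] by blast
      ultimately show ?thesis
        using \<phi>(2)[of "shift \<beta> f"] by (simp add: backward_shift)
    qed
    then have "\<forall>\<alpha>. \<phi> (unit_family \<alpha>) = 0"
      using f(2) van[OF \<phi>(1)] unfolding backward_injective_def by blast
    then show False
      using det[OF \<phi>(1) _ x] \<phi>(3) by blast
  qed
  then have "M.mtopology closure_of ?V = X"
    using closure_of_subset_topspace[of M.mtopology ?V] by auto
  then show ?thesis
    using VX finite_support_mem[OF family_subspace_carrier unit f(1)]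
    by (simp add: cyclic_element_def dense_in_topology_def norm_topology_def)
qed

section \<open>Reflexive ideal sequence spaces\<close>

context ISL
begin

lemma coordinate_functional_mem: "(\<lambda>x. if x \<in> X then x \<alpha> else 0) \<in> banach_dual X nrm"
  using cmod_mult_nrm_unit_le[of _ \<alpha>] nrm_unit_pos[of \<alpha>]
  by (intro banach_dualI[where C = "1 / nrm (unit_family \<alpha>)"]) (simp_all add: add_mem scale_mem field_simps)

text \<open>Cutting x down to \<open>F\<close> and rotating its entries makes all terms of \<phi>
  nonnegative, and by solidity this does not increase the norm. Consequently the values of \<phi> at
  the unit families form an element of X'.\<close>

lemma sum_cmod_banach_dual_le:
  assumes \<phi>: "\<phi> \<in> banach_dual X nrm" and x: "x \<in> X" and F: "finite F"
  shows "(\<Sum>\<alpha>\<in>F. cmod (x \<alpha> * \<phi> (unit_family \<alpha>))) \<le> banach_dual_norm X nrm \<phi> * nrm x"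
proof -
  define \<theta> where "\<theta> \<alpha> = cnj (sgn (x \<alpha> * \<phi> (unit_family \<alpha>)))" for \<alpha>
  define g where "g = (\<lambda>\<beta>. \<Sum>\<alpha>\<in>F. (\<theta> \<alpha> * x \<alpha>) * unit_family \<alpha> \<beta>)"
  have "cmod (g \<beta>) \<le> cmod (x \<beta>)" for \<beta>
  proof -
    have "g \<beta> = (\<Sum>\<alpha>\<in>F. if \<alpha> = \<beta> then \<theta> \<beta> * x \<beta> else 0)"
      unfolding g_def by (intro sum.cong) (auto simp: unit_family_def)
    then have "g \<beta> = (if \<beta> \<in> F then \<theta> \<beta> * x \<beta> else 0)"
      using F by simp
    then show ?thesis
      by (simp add: \<theta>_def norm_mult norm_sgn)
  qed
  then have g: "g \<in> X" "nrm g \<le> nrm x"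
    using solid[OF x] by blast+
  have "\<phi> g = (\<Sum>\<alpha>\<in>F. (\<theta> \<alpha> * x \<alpha>) * \<phi> (unit_family \<alpha>))"
    unfolding g_def by (rule banach_dual_sum[OF \<phi> unit_family_mem])
  also have "\<dots> = (\<Sum>\<alpha>\<in>F. complex_of_real (cmod (x \<alpha> * \<phi> (unit_family \<alpha>))))"
    by (intro sum.cong refl) (simp add: \<theta>_def mult_cnj_sgn[symmetric] mult.commute mult.left_commute)
  finally have "(\<Sum>\<alpha>\<in>F. cmod (x \<alpha> * \<phi> (unit_family \<alpha>))) = cmod (\<phi> g)"
    by (simp add: sum_nonneg del: of_real_sum flip: of_real_sum)
  also have "\<dots> \<le> banach_dual_norm X nrm \<phi> * nrm g"
    by (rule cmod_le_banach_dual_norm_mult[OF \<phi> g(1)])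
  also have "\<dots> \<le> banach_dual_norm X nrm \<phi> * nrm x"
    using normed_family_space.nrm_nonneg[OF normed_family_space_banach_dual \<phi>]
    by (intro mult_left_mono g)
  finally show ?thesis .
qed

lemma abs_summable_banach_dual:
  assumes "\<phi> \<in> banach_dual X nrm" "x \<in> X"
  shows "(\<lambda>\<alpha>. cmod (x \<alpha> * \<phi> (unit_family \<alpha>))) summable_on UNIV"
  using sum_cmod_banach_dual_le[OF assms]
  by (intro nonneg_bdd_above_summable_on bdd_aboveI2) auto

text \<open>
  The functional \<open>\<phi> \<mapsto> \<Sum>\<^sub>\<alpha> x\<^sub>\<alpha> \<phi>(\<delta>\<^sub>\<alpha>)\<close> is represented by some element, which the coordinate
  functionals show to be \<open>x\<close>.
\<close>

lemma reflexive_banach_dual_eq_infsum: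
  assumes refl: "reflexive_space X nrm" and \<phi>: "\<phi> \<in> banach_dual X nrm" and x: "x \<in> X"
  shows "\<phi> x = (\<Sum>\<^sub>\<infinity>\<alpha>. x \<alpha> * \<phi> (unit_family \<alpha>))"
proof -
  interpret D: normed_family_space "banach_dual X nrm" "banach_dual_norm X nrm"
    by (rule normed_family_space_banach_dual)
  define \<Phi> where "\<Phi> \<psi> = (if \<psi> \<in> banach_dual X nrm then \<Sum>\<^sub>\<infinity>\<alpha>. x \<alpha> * \<psi> (unit_family \<alpha>) else 0)" for \<psi>
  note summable = abs_summable_summable[OF abs_summable_banach_dual[OF _ x]]
  have "\<Phi> \<in> banach_dual (banach_dual X nrm) (banach_dual_norm X nrm)"
  proof (rule D.banach_dualI[where C = "nrm x"])
    fix \<psi> assume \<psi>: "\<psi> \<in> banach_dual X nrm"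
    show "\<Phi> (\<lambda>x. c * \<psi> x) = c * \<Phi> \<psi>" for c
      using \<psi> by (simp add: \<Phi>_def D.scale_mem mult.left_commute infsum_cmult_right')
    have "cmod (\<Phi> \<psi>) \<le> (\<Sum>\<^sub>\<infinity>\<alpha>. cmod (x \<alpha> * \<psi> (unit_family \<alpha>)))"
      using norm_infsum_bound[OF abs_summable_banach_dual[OF \<psi> x]] \<psi> by (simp add: \<Phi>_def)
    also have "\<dots> \<le> banach_dual_norm X nrm \<psi> * nrm x"
      by (intro infsum_le_finite_sums abs_summable_banach_dual \<psi> x sum_cmod_banach_dual_le)
    finally show "cmod (\<Phi> \<psi>) \<le> nrm x * banach_dual_norm X nrm \<psi>"
      by (simp add: mult.commute)
    fix \<psi>' assume \<psi>': "\<psi>' \<in> banach_dual X nrm"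
    show "\<Phi> (\<lambda>x. \<psi> x + \<psi>' x) = \<Phi> \<psi> + \<Phi> \<psi>'"
      using infsum_add[OF summable[OF \<psi>] summable[OF \<psi>']] \<psi> \<psi>'
      by (simp add: \<Phi>_def D.add_mem distrib_left)
  qed (simp add: \<Phi>_def)
  then obtain z where z: "z \<in> X" "\<And>\<psi>. \<psi> \<in> banach_dual X nrm \<Longrightarrow> \<Phi> \<psi> = \<psi> z"
    using refl unfolding reflexive_space_def by blast
  have "z \<alpha> = x \<alpha>" for \<alpha>
  proof -
    let ?c = "\<lambda>x. if x \<in> X then x \<alpha> else 0"
    have "z \<alpha> = \<Phi> ?c"
      using z coordinate_functional_mem[of \<alpha>] by simp
    also have "\<dots> = (\<Sum>\<^sub>\<infinity>\<beta>. x \<beta> * unit_family \<beta> \<alpha>)"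
      using coordinate_functional_mem[of \<alpha>] by (simp add: \<Phi>_def unit_family_mem)
    also have "\<dots> = pairing (unit_family \<alpha>) x"
      unfolding pairing_def by (intro infsum_cong) (simp add: unit_family_def)
    finally show ?thesis by (simp add: pairing_unit_family)
  qed
  then have "z = x" by blast
  then show ?thesis
    using z(2)[OF \<phi>] \<phi> by (simp add: \<Phi>_def)
qed

text \<open>
  Otherwise the unit families along which \<open>\<phi>\<close> is large span a copy of \<open>\<ell>\<^sup>1\<close>: separating \<open>\<phi>\<close> from
  the functionals that vanish at infinity gives a functional on the dual that cannot come from \<open>X\<close>.
\<close>

lemma reflexive_vanishing:
  assumes refl: "reflexive_space X nrm" and l1: "lp_space 1 \<subseteq> X" and \<phi>: "\<phi> \<in> banach_dual X nrm"
  shows "vanishing (\<lambda>\<alpha>. \<phi> (unit_family \<alpha>))"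
proof (rule ccontr)
  assume "\<not> ?thesis"
  then obtain e where e: "0 < e" "infinite {\<alpha>. e \<le> cmod (\<phi> (unit_family \<alpha>))}"
    by (auto simp: vanishing_def)
  interpret D: normed_family_space "banach_dual X nrm" "banach_dual_norm X nrm"
    by (rule normed_family_space_banach_dual)
  obtain C where C: "\<And>\<alpha>. nrm (unit_family \<alpha>) \<le> C"
    using nrm_unit_bounded[OF l1] by blast
  then have "0 < C" using nrm_unit_pos less_le_trans by blast
  define W where "W = {\<psi> \<in> banach_dual X nrm. vanishing (\<lambda>\<alpha>. \<psi> (unit_family \<alpha>))}"
  have W: "family_subspace W" "W \<subseteq> banach_dual X nrm"
    by (auto simp: family_subspace_def W_def D.zero_mem D.add_mem D.scale_mem vanishing_zero
        vanishing_add vanishing_cmult)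
  \<comment> \<open>At some unit family \<phi> has modulus at least e while \<psi> is below e / 2,
    and the norm of that unit family is at most C.\<close>
  have "e / (2 * C) \<le> banach_dual_norm X nrm (\<lambda>x. \<psi> x + \<phi> x)" if "\<psi> \<in> W" for \<psi>
  proof -
    have \<psi>: "\<psi> \<in> banach_dual X nrm" "vanishing (\<lambda>\<alpha>. \<psi> (unit_family \<alpha>))"
      using that by (auto simp: W_def)
    then have "finite {\<alpha>. e / 2 \<le> cmod (\<psi> (unit_family \<alpha>))}"
      using half_gt_zero[OF e(1)] unfolding vanishing_def by blast
    with e(2) have "infinite ({\<alpha>. e \<le> cmod (\<phi> (unit_family \<alpha>))} - {\<alpha>. e / 2 \<le> cmod (\<psi> (unit_family \<alpha>))})"
      by (rule Diff_infinite_finite[rotated])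
    then obtain \<alpha> where "e \<le> cmod (\<phi> (unit_family \<alpha>))" "cmod (\<psi> (unit_family \<alpha>)) < e / 2"
      using not_finite_existsD[of "\<lambda>\<alpha>. e \<le> cmod (\<phi> (unit_family \<alpha>)) \<and> cmod (\<psi> (unit_family \<alpha>)) < e / 2"]
      by (auto simp: set_diff_eq not_le)
    then have "e / 2 \<le> cmod (\<psi> (unit_family \<alpha>) + \<phi> (unit_family \<alpha>))"
      using norm_diff_ineq[of "\<phi> (unit_family \<alpha>)" "\<psi> (unit_family \<alpha>)"] by (simp add: add.commute)
    also have "\<dots> \<le> banach_dual_norm X nrm (\<lambda>x. \<psi> x + \<phi> x) * nrm (unit_family \<alpha>)"
      by (rule cmod_le_banach_dual_norm_mult[OF D.add_mem[OF \<psi>(1) \<phi>] unit_family_mem])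
    also have "\<dots> \<le> banach_dual_norm X nrm (\<lambda>x. \<psi> x + \<phi> x) * C"
      by (intro mult_left_mono C D.nrm_nonneg D.add_mem \<psi>(1) \<phi>)
    finally show ?thesis
      using \<open>0 < C\<close> by (simp add: field_simps)
  qed
  moreover have "0 < e / (2 * C)" using e(1) \<open>0 < C\<close> by simp
  ultimately obtain \<Phi> where \<Phi>: "\<Phi> \<in> banach_dual (banach_dual X nrm) (banach_dual_norm X nrm)"
      "\<And>\<psi>. \<psi> \<in> W \<Longrightarrow> \<Phi> \<psi> = 0" "\<Phi> \<phi> \<noteq> 0"
    using D.exists_separating_functional[OF W \<phi>, of "e / (2 * C)"] by blast
  then obtain z where z: "z \<in> X" "\<And>\<psi>. \<psi> \<in> banach_dual X nrm \<Longrightarrow> \<Phi> \<psi> = \<psi> z"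
    using refl unfolding reflexive_space_def by blast
  \<comment> \<open>Each coordinate functional is nonzero at one unit family only, hence belongs to
    \<open>W\<close> and is annihilated by \<Phi>.\<close>
  have "z \<alpha> = 0" for \<alpha>
  proof -
    let ?c = "\<lambda>x. if x \<in> X then x \<alpha> else 0"
    have "finite {\<beta>. d \<le> cmod (?c (unit_family \<beta>))}" if "0 < d" for d
      by (rule finite_subset[of _ "{\<alpha>}"]) (use that in \<open>auto simp: unit_family_def split: if_splits\<close>)
    then have "?c \<in> W"
      unfolding W_def vanishing_def using coordinate_functional_mem[of \<alpha>] by blast
    then have "\<Phi> ?c = 0" by (rule \<Phi>(2))
    then show ?thesis
      using z coordinate_functional_mem[of \<alpha>] by simp
  qed
  then have "z = (\<lambda>_. 0)" by blast
  then have "\<phi> z = 0"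
    using banach_dualD(2)[OF \<phi> zero_mem, of 0] by simp
  then show False
    using z(2)[OF \<phi>] \<Phi>(3) by simp
qed

lemma cyclic_norm_topology_reflexive:
  assumes "reflexive_space X nrm" "lp_space 1 \<subseteq> X" "finite {\<alpha>. f \<alpha> \<noteq> 0}" "backward_injective f"
  shows "cyclic_element (norm_topology X nrm) f"
proof (rule cyclic_norm_topology[OF normed_family_space_axioms unit_family_mem reflexive_vanishing[OF assms(1,2)] _ assms(3,4)])
  fix \<phi> x assume "\<phi> \<in> banach_dual X nrm" "\<forall>\<alpha>. \<phi> (unit_family \<alpha>) = 0" "x \<in> X"
  then show "\<phi> x = 0"
    by (simp add: reflexive_banach_dual_eq_infsum[OF assms(1)])
qed

end

section \<open>The spaces of \<open>p\<close>-summable families\<close>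

lemma powr_convex_comb_le:
  fixes u v t p :: real
  assumes "1 \<le> p" "0 \<le> u" "0 \<le> v" "0 < t" "t < 1"
  shows "(t * u + (1 - t) * v) powr p \<le> t * u powr p + (1 - t) * v powr p"
proof -
  \<comment> \<open>When one of the two arguments is 0, convexity comes down to
    \<open>s powr p \<le> s\<close> for s below 1.\<close>
  have pow: "(s * w) powr p \<le> s * w powr p" if "0 < s" "s < 1" "0 \<le> w" for s w :: real
    using powr_mono'[of 1 p s] that assms(1) by (simp add: powr_mult mult_right_mono)
  consider "u = 0" | "v = 0" | "0 < u" "0 < v"
    using assms by linarith
  then show ?thesis
  proof cases
    case 3
    then show ?thesis
      using convex_onD[OF powr_convex[OF assms(1)], of "1 - t" u v] assms by simp
  qed (use pow[of t u] pow[of "1 - t" v] assms in simp_all)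
qed

definition lp_sum :: "real \<Rightarrow> ('i \<Rightarrow> complex) \<Rightarrow> real"
  where "lp_sum p x = (\<Sum>\<^sub>\<infinity>\<alpha>. cmod (x \<alpha>) powr p)"

lemma lp_sum_nonneg: "0 \<le> lp_sum p x"
  unfolding lp_sum_def by (rule infsum_nonneg) simp

lemma lp_norm_eq: "lp_norm p x = lp_sum p x powr (1 / p)"
  by (simp add: lp_norm_def lp_sum_def)

lemma lp_sum_eq: "0 < p \<Longrightarrow> lp_sum p x = lp_norm p x powr p"
  by (simp add: lp_norm_eq powr_powr lp_sum_nonneg)

lemma lp_norm_nonneg: "0 \<le> lp_norm p x"
  by (simp add: lp_norm_eq)

lemma lp_norm_le:
  assumes "0 < p" "0 \<le> a" "lp_sum p x \<le> a powr p"
  shows "lp_norm p x \<le> a"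
  using powr_mono2[OF _ lp_sum_nonneg assms(3), of "1 / p"] assms
  by (simp add: lp_norm_eq powr_powr)

text \<open>
  Minkowski's inequality in terms of upper bounds for the norms: \<open>x + y\<close> is \<open>a + b\<close> times a convex
  combination of \<open>x / a\<close> and \<open>y / b\<close>.
\<close>

lemma lp_sum_add_le:
  assumes p: "1 \<le> p" and x: "x \<in> lp_space p" and y: "y \<in> lp_space p"
    and a: "0 < a" "lp_sum p x \<le> a powr p" and b: "0 < b" "lp_sum p y \<le> b powr p"
  shows "(\<lambda>\<alpha>. x \<alpha> + y \<alpha>) \<in> lp_space p" "lp_sum p (\<lambda>\<alpha>. x \<alpha> + y \<alpha>) \<le> (a + b) powr p"
proof -
  define t where "t = a / (a + b)"
  have t: "0 < t" "t < 1" and t': "1 - t = b / (a + b)"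
    using a b by (auto simp: t_def field_simps)
  define g where "g \<alpha> = (a + b) powr p * (t / a powr p) * cmod (x \<alpha>) powr p
      + (a + b) powr p * ((1 - t) / b powr p) * cmod (y \<alpha>) powr p" for \<alpha>
  have le: "cmod (x \<alpha> + y \<alpha>) powr p \<le> g \<alpha>" for \<alpha>
  proof -
    have "cmod (x \<alpha> + y \<alpha>) powr p \<le> (cmod (x \<alpha>) + cmod (y \<alpha>)) powr p"
      using p by (intro powr_mono2 norm_triangle_ineq) auto
    also have "cmod (x \<alpha>) + cmod (y \<alpha>) = (a + b) * (t * (cmod (x \<alpha>) / a) + (1 - t) * (cmod (y \<alpha>) / b))"
      using a b by (simp add: t' distrib_left) (simp add: t_def)
    also have "\<dots> powr p = (a + b) powr p * (t * (cmod (x \<alpha>) / a) + (1 - t) * (cmod (y \<alpha>) / b)) powr p"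
      using a b t by (intro powr_mult)
    also have "\<dots> \<le> (a + b) powr p * (t * (cmod (x \<alpha>) / a) powr p + (1 - t) * (cmod (y \<alpha>) / b) powr p)"
      using a b t p by (intro mult_left_mono powr_convex_comb_le) auto
    also have "\<dots> = g \<alpha>"
      using a b by (simp add: g_def powr_divide algebra_simps)
    finally show ?thesis .
  qed
  have sx: "(\<lambda>\<alpha>. cmod (x \<alpha>) powr p) summable_on UNIV" and sy: "(\<lambda>\<alpha>. cmod (y \<alpha>) powr p) summable_on UNIV"
    using x y by (simp_all add: lp_space_def)
  have sg: "g summable_on UNIV"
    unfolding g_def by (intro summable_on_add summable_on_cmult_right sx sy)
  have sxy: "(\<lambda>\<alpha>. cmod (x \<alpha> + y \<alpha>) powr p) summable_on UNIV"
    by (rule summable_on_comparison_test[OF sg]) (simp_all add: le)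
  then show "(\<lambda>\<alpha>. x \<alpha> + y \<alpha>) \<in> lp_space p"
    by (simp add: lp_space_def)
  have "lp_sum p (\<lambda>\<alpha>. x \<alpha> + y \<alpha>) \<le> infsum g UNIV"
    unfolding lp_sum_def by (intro infsum_mono sxy sg le)
  also have "\<dots> = (a + b) powr p * (t / a powr p) * lp_sum p x + (a + b) powr p * ((1 - t) / b powr p) * lp_sum p y"
    unfolding g_def lp_sum_def
    using infsum_add[OF summable_on_cmult_right[OF sx] summable_on_cmult_right[OF sy]]
    by (simp only: infsum_cmult_right')
  also have "\<dots> \<le> (a + b) powr p * (t / a powr p) * a powr p + (a + b) powr p * ((1 - t) / b powr p) * b powr p"
    using a b t by (intro add_mono mult_left_mono) auto
  also have "\<dots> = (a + b) powr p * t + (a + b) powr p * (1 - t)"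
    using a b by simp
  also have "\<dots> = (a + b) powr p"
    by (simp add: algebra_simps)
  finally show "lp_sum p (\<lambda>\<alpha>. x \<alpha> + y \<alpha>) \<le> (a + b) powr p" .
qed

lemma cmod_le_lp_norm:
  assumes "0 < p" "x \<in> lp_space p"
  shows "cmod (x \<alpha>) \<le> lp_norm p x"
proof -
  have "cmod (x \<alpha>) powr p \<le> lp_sum p x"
    using finite_sum_le_infsum[of "\<lambda>\<alpha>. cmod (x \<alpha>) powr p" UNIV "{\<alpha>}"] assms(2)
    by (simp add: lp_sum_def lp_space_def)
  then have "(cmod (x \<alpha>) powr p) powr (1 / p) \<le> lp_sum p x powr (1 / p)"
    using assms(1) by (intro powr_mono2) auto
  then show ?thesis
    using assms(1) by (simp add: lp_norm_eq powr_powr)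
qed

lemma normed_family_space_lp:
  assumes p: "1 \<le> p"
  shows "normed_family_space (lp_space p) (lp_norm p)"
proof
  show zero: "(\<lambda>_. 0) \<in> lp_space p"
    by (simp add: lp_space_def)
  fix x :: "'i \<Rightarrow> complex" assume x: "x \<in> lp_space p"
  show "0 \<le> lp_norm p x" by (rule lp_norm_nonneg)
  show "lp_norm p x = 0 \<longleftrightarrow> x = (\<lambda>\<alpha>. 0)"
  proof
    assume "lp_norm p x = 0"
    then show "x = (\<lambda>\<alpha>. 0)"
      using cmod_le_lp_norm[OF _ x] p by (auto simp: fun_eq_iff)
  qed (simp add: lp_norm_def)
  show "(\<lambda>\<alpha>. c * x \<alpha>) \<in> lp_space p" for c
    using x by (simp add: lp_space_def norm_mult powr_mult summable_on_cmult_right)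
  show "lp_norm p (\<lambda>\<alpha>. c * x \<alpha>) = cmod c * lp_norm p x" for c
    using p lp_sum_nonneg[of p x]
    by (simp add: lp_norm_def lp_sum_def norm_mult powr_mult infsum_cmult_right' powr_powr)
  fix y :: "'i \<Rightarrow> complex" assume y: "y \<in> lp_space p"
  \<comment> \<open>Padding the norms by e keeps the two bounds positive, as Minkowski's inequality
    above requires, even for the zero family.\<close>
  have bound: "lp_sum p z \<le> (lp_norm p z + e) powr p" if "0 < e" for z :: "'i \<Rightarrow> complex" and e
    using p that lp_norm_nonneg[of p z] powr_mono2[of p "lp_norm p z" "lp_norm p z + e"]
    by (simp add: lp_sum_eq)
  have pos: "0 < lp_norm p z + e" if "0 < e" for z :: "'i \<Rightarrow> complex" and e
    using that lp_norm_nonneg[of p z] by linarith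
  note add = lp_sum_add_le[OF p x y pos bound pos bound]
  show "(\<lambda>\<alpha>. x \<alpha> + y \<alpha>) \<in> lp_space p"
    by (rule add(1)[of 1 1]) simp_all
  show "lp_norm p (\<lambda>\<alpha>. x \<alpha> + y \<alpha>) \<le> lp_norm p x + lp_norm p y"
  proof (rule field_le_epsilon)
    fix e :: real assume "0 < e"
    then have e: "0 < e / 2" by simp
    have "lp_norm p (\<lambda>\<alpha>. x \<alpha> + y \<alpha>) \<le> (lp_norm p x + e / 2) + (lp_norm p y + e / 2)"
      using p pos[OF e, of x] pos[OF e, of y] by (intro lp_norm_le add(2) e) auto
    then show "lp_norm p (\<lambda>\<alpha>. x \<alpha> + y \<alpha>) \<le> lp_norm p x + lp_norm p y + e" by simp
  qed
qed

lemma lp_sum_finite_support: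
  assumes "finite F" "\<And>\<alpha>. \<alpha> \<notin> F \<Longrightarrow> x \<alpha> = 0"
  shows "x \<in> lp_space p" "lp_sum p x = (\<Sum>\<alpha>\<in>F. cmod (x \<alpha>) powr p)"
proof -
  have "((\<lambda>\<alpha>. cmod (x \<alpha>) powr p) has_sum (\<Sum>\<alpha>\<in>F. cmod (x \<alpha>) powr p)) UNIV"
    by (rule has_sum_finite_neutralI) (use assms in auto)
  then show "x \<in> lp_space p" "lp_sum p x = (\<Sum>\<alpha>\<in>F. cmod (x \<alpha>) powr p)"
    by (auto simp: lp_space_def lp_sum_def summable_on_def infsumI)
qed

section \<open>Functionals on the spaces of p-summable families\<close>

lemma unit_family_mem_lp: "unit_family \<alpha> \<in> lp_space p"
  by (rule lp_sum_finite_support(1)[of "{\<alpha>}"]) (auto simp: unit_family_def)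

text \<open>A sum of n rotated unit families has norm at most n^(1/p), but \<phi> takes on it a
  value of at least n e if all n were chosen where \<phi> is at least e in modulus. Since p > 1,
  this contradicts boundedness for large n.\<close>

lemma lp_vanishing:
  assumes p: "1 < p" and \<phi>: "\<phi> \<in> banach_dual (lp_space p) (lp_norm p)"
  shows "vanishing (\<lambda>\<alpha>. \<phi> (unit_family \<alpha>))"
proof (rule ccontr)
  interpret normed_family_space "lp_space p" "lp_norm p"
    using p by (intro normed_family_space_lp) simp
  assume "\<not> ?thesis"
  then obtain e where e: "0 < e" "infinite {\<alpha>. e \<le> cmod (\<phi> (unit_family \<alpha>))}"
    by (auto simp: vanishing_def)
  define C where "C = banach_dual_norm (lp_space p) (lp_norm p) \<phi>"
  have le: "real n * e \<le> C * real n powr (1 / p)" for n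
  proof -
    obtain F where F: "F \<subseteq> {\<alpha>. e \<le> cmod (\<phi> (unit_family \<alpha>))}" "finite F" "card F = n"
      using infinite_arbitrarily_large[OF e(2), of n] by blast
    define x where "x = (\<lambda>\<beta>. \<Sum>\<alpha>\<in>F. cnj (sgn (\<phi> (unit_family \<alpha>))) * unit_family \<alpha> \<beta>)"
    have x_eq: "x \<beta> = (if \<beta> \<in> F then cnj (sgn (\<phi> (unit_family \<beta>))) else 0)" for \<beta>
    proof -
      have "x \<beta> = (\<Sum>\<alpha>\<in>F. if \<alpha> = \<beta> then cnj (sgn (\<phi> (unit_family \<beta>))) else 0)"
        unfolding x_def by (intro sum.cong) (auto simp: unit_family_def)
      then show ?thesis using F(2) by simp
    qed
    note fin = lp_sum_finite_support[OF F(2), of x p]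
    have xX: "x \<in> lp_space p" by (rule fin(1)) (simp add: x_eq)
    have "lp_sum p x = (\<Sum>\<alpha>\<in>F. cmod (x \<alpha>) powr p)" by (rule fin(2)) (simp add: x_eq)
    also have "\<dots> \<le> (\<Sum>\<alpha>\<in>F. 1)"
      by (intro sum_mono) (simp add: x_eq norm_sgn)
    finally have nx: "lp_norm p x \<le> real n powr (1 / p)"
      unfolding lp_norm_eq using p F(3) lp_sum_nonneg by (intro powr_mono2) auto
    have "\<phi> x = (\<Sum>\<alpha>\<in>F. cnj (sgn (\<phi> (unit_family \<alpha>))) * \<phi> (unit_family \<alpha>))"
      unfolding x_def by (rule banach_dual_sum[OF \<phi> unit_family_mem_lp])
    also have "\<dots> = (\<Sum>\<alpha>\<in>F. complex_of_real (cmod (\<phi> (unit_family \<alpha>))))"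
      by (intro sum.cong refl) (simp add: mult_cnj_sgn[symmetric] mult.commute)
    finally have "cmod (\<phi> x) = (\<Sum>\<alpha>\<in>F. cmod (\<phi> (unit_family \<alpha>)))"
      by (simp add: sum_nonneg del: of_real_sum flip: of_real_sum)
    moreover have "real n * e \<le> (\<Sum>\<alpha>\<in>F. cmod (\<phi> (unit_family \<alpha>)))"
      using F(1,3) sum_mono[of F "\<lambda>_. e" "\<lambda>\<alpha>. cmod (\<phi> (unit_family \<alpha>))"] by auto
    moreover have "cmod (\<phi> x) \<le> C * lp_norm p x"
      unfolding C_def by (rule cmod_le_banach_dual_norm_mult[OF \<phi> xX])
    moreover have "C * lp_norm p x \<le> C * real n powr (1 / p)"
      unfolding C_def using normed_family_space.nrm_nonneg[OF normed_family_space_banach_dual \<phi>]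
      by (intro mult_left_mono nx)
    ultimately show ?thesis by linarith
  qed
  define q where "q = 1 - 1 / p"
  have q: "0 < q" using p by (simp add: q_def)
  have "0 \<le> C"
    unfolding C_def by (rule normed_family_space.nrm_nonneg[OF normed_family_space_banach_dual \<phi>])
  \<comment> \<open>Chosen so that n^(1 - 1/p) exceeds C / e; the summand 1 makes this strict and
    keeps n positive even for C = 0.\<close>
  obtain n :: nat where n: "(C / e + 1) powr (1 / q) \<le> real n"
    using real_arch_simple by blast
  have "C / e + 1 = ((C / e + 1) powr (1 / q)) powr q"
    using q \<open>0 \<le> C\<close> e(1) by (simp add: powr_powr)
  also have "\<dots> \<le> real n powr q"
    using q n by (intro powr_mono2) auto
  finally have big: "C / e + 1 \<le> real n powr q" .
  then have npos: "0 < real n"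
    using \<open>0 \<le> C\<close> e(1) q by (cases "n = 0") (auto simp: add_nonneg_pos field_simps)
  have eq: "real n powr q * real n powr (1 / p) = real n"
    using npos by (simp add: q_def flip: powr_add)
  have "real n powr q * real n powr (1 / p) * e \<le> C * real n powr (1 / p)"
    unfolding eq by (rule le)
  then have "real n powr q * e * real n powr (1 / p) \<le> C * real n powr (1 / p)"
    by (simp add: mult.assoc mult.commute)
  then have "real n powr q \<le> C / e"
    using npos e(1) by (simp add: field_simps)
  with big show False by simp
qed

text \<open>Density of the finite families: \<phi> kills a finite part of x, and the remaining tail
  has arbitrarily small norm.\<close>

lemma lp_banach_dual_eq_0:
  assumes p: "1 \<le> p" and \<phi>: "\<phi> \<in> banach_dual (lp_space p) (lp_norm p)"
    and zero: "\<forall>\<alpha>. \<phi> (unit_family \<alpha>) = 0" and x: "x \<in> lp_space p"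
  shows "\<phi> x = 0"
proof -
  interpret normed_family_space "lp_space p" "lp_norm p"
    using p by (rule normed_family_space_lp)
  define C where "C = banach_dual_norm (lp_space p) (lp_norm p) \<phi>"
  have C: "0 \<le> C"
    unfolding C_def by (rule normed_family_space.nrm_nonneg[OF normed_family_space_banach_dual \<phi>])
  have summable: "(\<lambda>\<alpha>. cmod (x \<alpha>) powr p) summable_on UNIV"
    using x by (simp add: lp_space_def)
  have "cmod (\<phi> x) \<le> C * d" if d: "0 < d" for d
  proof -
    obtain F where F: "finite F" "dist (\<Sum>\<alpha>\<in>F. cmod (x \<alpha>) powr p) (lp_sum p x) \<le> d powr p"
      using infsum_finite_approximation[OF summable, of "d powr p"] d by (auto simp: lp_sum_def)
    define y where "y = (\<lambda>\<alpha>. if \<alpha> \<in> F then x \<alpha> else 0)"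
    define z where "z = (\<lambda>\<alpha>. if \<alpha> \<in> F then 0 else x \<alpha>)"
    have "{\<alpha>. y \<alpha> \<noteq> 0} \<subseteq> F" by (auto simp: y_def)
    then have fin: "finite {\<alpha>. y \<alpha> \<noteq> 0}" using F(1) by (rule finite_subset)
    then have y: "y \<in> lp_space p" "\<phi> y = 0"
      using finite_support_mem[OF family_subspace_carrier unit_family_mem_lp]
        banach_dual_finite_support[OF \<phi> unit_family_mem_lp fin] zero by auto
    have z_eq: "z = (\<lambda>\<alpha>. x \<alpha> - y \<alpha>)" and x_eq: "x = (\<lambda>\<alpha>. y \<alpha> + z \<alpha>)"
      by (auto simp: y_def z_def)
    have z: "z \<in> lp_space p" unfolding z_eq by (rule minus_mem[OF x y(1)])
    have "lp_sum p z = infsum (\<lambda>\<alpha>. cmod (x \<alpha>) powr p) (UNIV - F)"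
      unfolding lp_sum_def by (rule infsum_cong_neutral) (auto simp: z_def)
    also have "\<dots> = lp_sum p x - (\<Sum>\<alpha>\<in>F. cmod (x \<alpha>) powr p)"
      using infsum_Diff[OF summable, of F] F(1) by (simp add: lp_sum_def)
    also have "\<dots> \<le> d powr p"
      using F(2) by (simp add: dist_real_def)
    finally have "lp_norm p z \<le> d"
      using p d by (intro lp_norm_le) auto
    have "\<phi> x = \<phi> z"
      using banach_dualD(1)[OF \<phi> y(1) z] y(2) x_eq by simp
    also have "cmod \<dots> \<le> C * lp_norm p z"
      unfolding C_def by (rule cmod_le_banach_dual_norm_mult[OF \<phi> z])
    also have "\<dots> \<le> C * d"
      by (intro mult_left_mono C \<open>lp_norm p z \<le> d\<close>)
    finally show ?thesis .
  qed
  \<comment> \<open>The tail bound is taken as e / C, or as 1 when C = 0.\<close>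
  from this[of "e / C" for e] this[of 1] have "cmod (\<phi> x) \<le> 0 + e" if "0 < e" for e
    using that C by (cases "C = 0") auto
  then have "cmod (\<phi> x) \<le> 0" by (rule field_le_epsilon)
  then show ?thesis by simp
qed

theorem proposition6p9:
  shows
    "(\<forall>(X :: (nat ^ 'n \<Rightarrow> complex) set) nrm (f :: nat ^ 'n \<Rightarrow>\<^sub>0 complex).
        ISL X nrm \<and> lp_space 1 \<subseteq> X \<and> finite_families_dense_in_dual X nrm \<and>
        linearly_factorable f \<and> (\<forall>\<zeta>\<in>polydisc. mpoly_eval f \<zeta> \<noteq> 0) \<longrightarrow>
        cyclic_element (weak_topology X) (Poly_Mapping.lookup f))
     \<and>
     (\<forall>f :: complex poly. (\<forall>\<zeta>. cmod \<zeta> < 1 \<longrightarrow> poly f \<zeta> \<noteq> 0) \<longrightarrow>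
        (\<forall>(X :: (nat \<Rightarrow> complex) set) nrm.
           ISL X nrm \<and> lp_space 1 \<subseteq> X \<and> finite_families_dense_in_dual X nrm \<longrightarrow>
           cyclic_element (weak_topology X) (coeff f))
        \<and>
        (\<forall>p. 1 < p \<longrightarrow> cyclic_element (norm_topology (lp_space p) (lp_norm p)) (coeff f))
        \<and>
        (\<forall>(X :: (nat \<Rightarrow> complex) set) nrm.
           ISL X nrm \<and> reflexive_space X nrm \<and> lp_space 1 \<subseteq> X \<longrightarrow>
           cyclic_element (norm_topology X nrm) (coeff f)))"
proof (intro conjI allI impI; (elim conjE)?)
  fix X :: "(nat ^ 'n \<Rightarrow> complex) set" and nrm and f :: "nat ^ 'n \<Rightarrow>\<^sub>0 complex"
  assume "ISL X nrm" "lp_space 1 \<subseteq> X" "finite_families_dense_in_dual X nrm"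
    "linearly_factorable f" "\<forall>\<zeta>\<in>polydisc. mpoly_eval f \<zeta> \<noteq> 0"
  then show "cyclic_element (weak_topology X) (Poly_Mapping.lookup f)"
    by (intro ISL.cyclic_weak_topology finite_lookup backward_injective_linearly_factorable) auto
next
  fix f :: "complex poly" assume "\<forall>\<zeta>. cmod \<zeta> < 1 \<longrightarrow> poly f \<zeta> \<noteq> 0"
  then have f: "backward_injective (coeff f)"
    by (intro backward_injective_coeff) blast
  {
    fix X :: "(nat \<Rightarrow> complex) set" and nrm
    assume "ISL X nrm" "lp_space 1 \<subseteq> X" "finite_families_dense_in_dual X nrm"
    then show "cyclic_element (weak_topology X) (coeff f)"
      by (intro ISL.cyclic_weak_topology finite_coeff f)
  next
    fix p :: real assume p: "1 < p"
    then have "1 \<le> p" by simp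
    then show "cyclic_element (norm_topology (lp_space p) (lp_norm p)) (coeff f)"
      using lp_vanishing[OF p] lp_banach_dual_eq_0
      by (intro cyclic_norm_topology normed_family_space_lp unit_family_mem_lp finite_coeff f)
  next
    fix X :: "(nat \<Rightarrow> complex) set" and nrm
    assume "ISL X nrm" "reflexive_space X nrm" "lp_space 1 \<subseteq> X"
    then show "cyclic_element (norm_topology X nrm) (coeff f)"
      by (intro ISL.cyclic_norm_topology_reflexive finite_coeff f)
  }
qed

end
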